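(* Let $\alpha_1\in\,]0,1[$, let $\Pi:\mathcal T\!or_{1,2}\to\mathbb H$ be the projection $(\tau,z_2)\mapsto\tau$ and let $\Xi:\mathcal T\!or_{1,2}\to\mathbb R^2$ be the map $$\Xi(\tau,z_2)=\Big(\frac{\operatorname{Im}z_2}{\operatorname{Im}\tau},\ \frac{\operatorname{Im}z_2}{\operatorname{Im}\tau}\,\tau-z_2\Big).$$ 1. The map $\Pi\times\Xi:\mathcal T\!or_{1,2}\to\mathbb H\times(\mathbb R^2\setminus\mathbb Z^2)$ is a real analytic isomorphism. 2. The push-forward of Veech's foliation $\mathcal F^{\alpha_1}$ on $\mathcal T\!or_{1,2}$ by this map is the horizontal foliation on the product $\mathbb H\times(\mathbb R^2\setminus\mathbb Z^2)$ (with leaves $\mathbb H\times\{r\}$). 3. By restriction, $\Pi$ induces a biholomorphism between any leaf of $\mathcal F^{\alpha_1}$ and the Poincaré half-plane $\mathbb H$. In particular, the leaves of Veech's foliation on $\mathcal T\!or_{1,2}$ are topologically trivial.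
   Context: For $\tau\in\mathbb H$: $\mathbb Z_\tau=\mathbb Z+\mathbb Z\tau$, $E_\tau=\mathbb C/\mathbb Z_\tau$. $\mathcal T\!or_{1,2}=\{(\tau,z_2)\in\mathbb H\times\mathbb C:z_2\notin\mathbb Z_\tau\}$ is the Torelli space of elliptic curves with two marked points $[0],[z_2]$. By Troyanov's theorem, for each $(\tau,z_2)$ there is a flat metric on $E_\tau$, unique up to scaling, compatible with the conformal structure, with cone angle $2\pi(1+\alpha_1)$ at $[0]$ and $2\pi(1-\alpha_1)$ at $[z_2]$. The linear holonomy map $h:\mathcal T\!or_{1,2}\to\mathbb U^2$ sends $(\tau,z_2)$ to the linear (rotational) holonomies of this metric along the loops of $E_\tau\setminus\{[0],[z_2]\}$ given by $t\mapsto\star+t$ and $t\mapsto\star+t\tau$ ($t\in[0,1]$, $\star=-\epsilon(1+i)$, $\epsilon>0$ small). Veech's foliation $\mathcal F^{\alpha_1}$ is the real-analytic foliation by complex curves whose leaves are the connected components of the level sets of $h$.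
   Formalization: The base point of the two holonomy loops is taken as −ε(1+τ) instead of −ε(1+i): with the latter the loop ⋆+tτ passes through [0] when Re τ = Im τ (e.g. τ=1+i), so h is undefined there and its level sets break. *)

theory Defs
  imports "HOL-Complex_Analysis.Complex_Analysis"
begin

section \<open>The Torelli space and the map \<open>\<Pi> \<times> \<Xi>\<close>\<close>

definition upper_half_plane :: "complex set" where
  "upper_half_plane = {\<tau>. Im \<tau> > 0}"

definition lattice :: "complex \<Rightarrow> complex set" where
  "lattice \<tau> = {of_int m + of_int n * \<tau> | m n. True}"

definition Tor12 :: "(complex \<times> complex) set" where
  "Tor12 = {(\<tau>, z\<^sub>2). \<tau> \<in> upper_half_plane \<and> z\<^sub>2 \<notin> lattice \<tau>}"

definition Tor_proj :: "complex \<times> complex \<Rightarrow> complex" where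
  "Tor_proj = (\<lambda>(\<tau>, z\<^sub>2). \<tau>)"

text \<open>The second coordinate of \<open>\<Xi>\<close> is given by a complex expression that is real on \<open>Tor12\<close>
  (lemma \<open>Tor_Xi_real\<close>); \<^const>\<open>Re\<close> only retypes it.\<close>

definition Tor_Xi :: "complex \<times> complex \<Rightarrow> real \<times> real" where
  "Tor_Xi = (\<lambda>(\<tau>, z\<^sub>2). (Im z\<^sub>2 / Im \<tau>, Re (of_real (Im z\<^sub>2 / Im \<tau>) * \<tau> - z\<^sub>2)))"

lemma Tor_Xi_real:
  assumes "(\<tau>, z\<^sub>2) \<in> Tor12"
  shows "of_real (Im z\<^sub>2 / Im \<tau>) * \<tau> - z\<^sub>2 = of_real (snd (Tor_Xi (\<tau>, z\<^sub>2)))"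
  using assms by (auto simp: Tor_Xi_def Tor12_def upper_half_plane_def complex_eq_iff)

definition Tor_PiXi :: "complex \<times> complex \<Rightarrow> complex \<times> (real \<times> real)" where
  "Tor_PiXi p = (Tor_proj p, Tor_Xi p)"

definition punctured_R2 :: "(real \<times> real) set" where
  "punctured_R2 = UNIV - \<int> \<times> \<int>"


section \<open>Real analytic isomorphisms\<close>

text \<open>Local expansion in a convergent multivariate power series; a multi-index is a function
  \<open>Basis \<rightarrow> nat\<close>.\<close>

definition real_analytic_on ::
    "('a::euclidean_space \<Rightarrow> 'b::euclidean_space) \<Rightarrow> 'a set \<Rightarrow> bool" where
  "real_analytic_on f S \<longleftrightarrow>
     (\<forall>a\<in>S. \<exists>r>0. \<exists>c :: ('a \<Rightarrow> nat) \<Rightarrow> 'b. ball a r \<subseteq> S \<and>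
        (\<forall>x\<in>ball a r.
           ((\<lambda>m. (\<Prod>i\<in>Basis. ((x - a) \<bullet> i) ^ m i) *\<^sub>R c m) has_sum f x)
             (Basis \<rightarrow>\<^sub>E UNIV)))"

definition real_analytic_iso ::
    "('a::euclidean_space \<Rightarrow> 'b::euclidean_space) \<Rightarrow> 'a set \<Rightarrow> 'b set \<Rightarrow> bool" where
  "real_analytic_iso f S T \<longleftrightarrow>
     bij_betw f S T \<and> real_analytic_on f S \<and> real_analytic_on (inv_into S f) T"


section \<open>Flat metrics with two cone points on an elliptic curve\<close>

text \<open>A metric on \<open>\<complex>/\<int>\<^sub>\<tau>\<close> compatible with the conformal structure is written
  \<open>\<phi>(z)\<^sup>2 |dz|\<^sup>2\<close> with \<open>\<phi>\<close> a \<open>\<int>\<^sub>\<tau>\<close>-periodic function on \<open>\<complex>\<close>; the values of \<open>\<phi>\<close> at the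
  cone points carry no meaning.  The following are the orientation-preserving local isometries to
  the Euclidean plane, i.e. the local developing maps.\<close>

definition developing_map :: "(complex \<Rightarrow> real) \<Rightarrow> complex set \<Rightarrow> (complex \<Rightarrow> complex) \<Rightarrow> bool" where
  "developing_map \<phi> U f \<longleftrightarrow>
     open U \<and> f holomorphic_on U \<and> (\<forall>z\<in>U. deriv f z \<noteq> 0 \<and> \<phi> z = cmod (deriv f z))"

text \<open>Cone angle \<open>\<theta>\<close> at \<open>p\<close>: in a suitable holomorphic coordinate \<open>w\<close> centred at \<open>p\<close>, the metric is
  the Euclidean cone \<open>|w\<^bsup>\<theta>/2\<pi> - 1\<^esup> dw|\<^sup>2\<close>.\<close>

definition has_cone_angle :: "(complex \<Rightarrow> real) \<Rightarrow> complex \<Rightarrow> real \<Rightarrow> bool" where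
  "has_cone_angle \<phi> p \<theta> \<longleftrightarrow>
     (\<exists>U w. open U \<and> p \<in> U \<and> w holomorphic_on U \<and> inj_on w U \<and> w p = 0 \<and>
        (\<forall>z\<in>U - {p}. \<phi> z = cmod (w z) powr (\<theta> / (2 * pi) - 1) * cmod (deriv w z)))"

definition cone_points :: "complex \<Rightarrow> complex \<Rightarrow> complex set" where
  "cone_points \<tau> z\<^sub>2 = lattice \<tau> \<union> (+) z\<^sub>2 ` lattice \<tau>"

definition flat_cone_metric :: "real \<Rightarrow> complex \<Rightarrow> complex \<Rightarrow> (complex \<Rightarrow> real) \<Rightarrow> bool" where
  "flat_cone_metric \<alpha>\<^sub>1 \<tau> z\<^sub>2 \<phi> \<longleftrightarrow>
     (\<forall>z. z \<notin> cone_points \<tau> z\<^sub>2 \<longrightarrow> (\<forall>l\<in>lattice \<tau>. \<phi> (z + l) = \<phi> z)) \<and>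
     (\<forall>z. z \<notin> cone_points \<tau> z\<^sub>2 \<longrightarrow> (\<exists>U f. z \<in> U \<and> developing_map \<phi> U f)) \<and>
     (\<forall>p\<in>lattice \<tau>. has_cone_angle \<phi> p (2 * pi * (1 + \<alpha>\<^sub>1))) \<and>
     (\<forall>p\<in>(+) z\<^sub>2 ` lattice \<tau>. has_cone_angle \<phi> p (2 * pi * (1 - \<alpha>\<^sub>1)))"

text \<open>By Troyanov's theorem such a metric exists for \<open>(\<tau>, z\<^sub>2)\<close> in \<open>Tor12\<close> and \<open>0 < \<alpha>\<^sub>1 < 1\<close>, and any
  two are proportional; the linear holonomy below does not depend on the scaling factor.\<close>

definition troyanov_metric :: "real \<Rightarrow> complex \<Rightarrow> complex \<Rightarrow> complex \<Rightarrow> real" where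
  "troyanov_metric \<alpha>\<^sub>1 \<tau> z\<^sub>2 = (SOME \<phi>. flat_cone_metric \<alpha>\<^sub>1 \<tau> z\<^sub>2 \<phi>)"


section \<open>Linear holonomy and Veech's foliation\<close>

text \<open>\<open>\<gamma>\<close> is a path in \<open>\<complex>\<close> whose end points differ by a period.  Along it, \<open>g\<close> is the derivative of
  a developing map continued analytically (the periods act by translations, so the tangent spaces at
  both ends are identified with \<open>\<complex>\<close>); going once around the loop turns the developing map \<open>D\<close> into
  \<open>\<zeta> D + b\<close>, and \<open>\<zeta>\<close> is the linear holonomy.  Parallel transport of tangent vectors along \<open>\<gamma>\<close> is
  multiplication by \<open>1/\<zeta>\<close>; this other convention gives the same foliation.\<close>

definition has_linear_holonomy :: "(complex \<Rightarrow> real) \<Rightarrow> (real \<Rightarrow> complex) \<Rightarrow> complex \<Rightarrow> bool" where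
  "has_linear_holonomy \<phi> \<gamma> \<zeta> \<longleftrightarrow>
     (\<exists>g. (\<forall>t\<in>{0..1}. \<exists>U f \<delta>. developing_map \<phi> U f \<and> \<delta> > 0 \<and>
              (\<forall>s\<in>{0..1}. \<bar>s - t\<bar> < \<delta> \<longrightarrow> \<gamma> s \<in> U \<and> g s = deriv f (\<gamma> s))) \<and>
          \<zeta> = g 1 / g 0)"

text \<open>The base point is \<open>-\<epsilon>(1 + \<tau>)\<close>, just off the corner \<open>0\<close> of the period parallelogram in both lattice
  directions.  The naive choice \<open>-\<epsilon>(1 + i)\<close> gives loops homotopic to these when \<open>Re \<tau> < Im \<tau>\<close>, but its
  second loop runs through \<open>[0]\<close> when \<open>Re \<tau> = Im \<tau>\<close> and passes on the other side of \<open>[0]\<close> when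
  \<open>Re \<tau> > Im \<tau>\<close>.\<close>

definition base_point :: "complex \<Rightarrow> real \<Rightarrow> complex" where
  "base_point \<tau> \<epsilon> = - of_real \<epsilon> * (1 + \<tau>)"

definition holonomy_map :: "real \<Rightarrow> complex \<times> complex \<Rightarrow> complex \<times> complex" where
  "holonomy_map \<alpha>\<^sub>1 = (\<lambda>(\<tau>, z\<^sub>2). THE (\<zeta>, \<zeta>').
     \<forall>\<^sub>F \<epsilon> in at_right 0.
       has_linear_holonomy (troyanov_metric \<alpha>\<^sub>1 \<tau> z\<^sub>2) (\<lambda>t. base_point \<tau> \<epsilon> + of_real t) \<zeta> \<and>
       has_linear_holonomy (troyanov_metric \<alpha>\<^sub>1 \<tau> z\<^sub>2) (\<lambda>t. base_point \<tau> \<epsilon> + of_real t * \<tau>) \<zeta>')"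

text \<open>A foliation is represented by the set of its leaves, which determines it.\<close>

definition veech_foliation :: "real \<Rightarrow> (complex \<times> complex) set set" where
  "veech_foliation \<alpha>\<^sub>1 = (\<Union>\<zeta>. components {p \<in> Tor12. holonomy_map \<alpha>\<^sub>1 p = \<zeta>})"

definition pushforward_foliation :: "('a \<Rightarrow> 'b) \<Rightarrow> 'a set set \<Rightarrow> 'b set set" where
  "pushforward_foliation f F = (`) f ` F"

definition horizontal_foliation :: "'a set \<Rightarrow> 'b set \<Rightarrow> ('a \<times> 'b) set set" where
  "horizontal_foliation A B = {A \<times> {r} | r. r \<in> B}"


section \<open>Biholomorphisms from complex curves in \<open>\<complex>\<^sup>2\<close>\<close>

text \<open>Local holomorphic parametrisations of an embedded complex curve.\<close>

definition holomorphic_into_C2 :: "(complex \<Rightarrow> complex \<times> complex) \<Rightarrow> complex set \<Rightarrow> bool" where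
  "holomorphic_into_C2 g U \<longleftrightarrow>
     (\<lambda>u. fst (g u)) holomorphic_on U \<and> (\<lambda>u. snd (g u)) holomorphic_on U"

definition curve_parametrization ::
    "(complex \<times> complex) set \<Rightarrow> complex set \<Rightarrow> (complex \<Rightarrow> complex \<times> complex) \<Rightarrow> bool" where
  "curve_parametrization L U g \<longleftrightarrow>
     open U \<and> holomorphic_into_C2 g U \<and>
     (\<forall>u\<in>U. deriv (\<lambda>u. fst (g u)) u \<noteq> 0 \<or> deriv (\<lambda>u. snd (g u)) u \<noteq> 0) \<and>
     openin (top_of_set L) (g ` U) \<and> (\<exists>k. homeomorphism U (g ` U) g k)"

definition complex_curve :: "(complex \<times> complex) set \<Rightarrow> bool" where
  "complex_curve L \<longleftrightarrow> (\<forall>p\<in>L. \<exists>U g. curve_parametrization L U g \<and> p \<in> g ` U)"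

definition holomorphic_on_curve ::
    "(complex \<times> complex \<Rightarrow> complex) \<Rightarrow> (complex \<times> complex) set \<Rightarrow> bool" where
  "holomorphic_on_curve f L \<longleftrightarrow>
     (\<forall>U g. curve_parametrization L U g \<longrightarrow> (\<lambda>u. f (g u)) holomorphic_on U)"

definition biholomorphism_curve ::
    "(complex \<times> complex \<Rightarrow> complex) \<Rightarrow> (complex \<times> complex) set \<Rightarrow> complex set \<Rightarrow> bool" where
  "biholomorphism_curve f L D \<longleftrightarrow>
     complex_curve L \<and> open D \<and> bij_betw f L D \<and>
     holomorphic_on_curve f L \<and> holomorphic_into_C2 (inv_into L f) D"

end

theory Submission
  imports Defs
begin

text \<open>Write \<open>z\<^sub>2 = a \<tau> - b\<close> with \<open>(a, b) = \<Xi>(\<tau>, z\<^sub>2)\<close>.  The flat metric is explicit: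
  \<open>\<phi>(z) = |exp(2\<pi>\<i> \<alpha>\<^sub>1 a z)| |\<theta>(z)|\<^bsup>\<alpha>\<^sub>1\<^esup> |\<theta>(z - z\<^sub>2)|\<^bsup>-\<alpha>\<^sub>1\<^esup>\<close>, where \<open>\<theta>\<close> is entire with simple zeros exactly on the
  lattice, \<open>\<theta>(z + 1) = \<theta>(z)\<close> and \<open>\<theta>(z + \<tau>) = - exp(-2\<pi>\<i>z) \<theta>(z)\<close>; any other one is proportional to it by the
  maximum principle.  Continuing \<open>exp(2\<pi>\<i> \<alpha>\<^sub>1 a z) (\<theta>(z) / \<theta>(z - z\<^sub>2))\<^bsup>\<alpha>\<^sub>1\<^esup>\<close> along the two loops gives the holonomies
  \<open>exp(2\<pi>\<i> \<alpha>\<^sub>1 (a - \<lfloor>a\<rfloor>))\<close> and \<open>exp(2\<pi>\<i> \<alpha>\<^sub>1 (b - \<lceil>b\<rceil>))\<close>; the integer parts appear because the loops are fixed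
  while \<open>z\<^sub>2\<close> moves across them.  As \<open>\<alpha>\<^sub>1 < 1\<close>, the level sets of the holonomy are the preimages of the cosets of
  \<open>\<int>\<^sup>2\<close> under \<open>\<Xi>\<close>, and their components are the fibres of \<open>\<Xi>\<close>.\<close>

section \<open>Theta functions\<close>

text \<open>\<open>troyanov_metric\<close> is picked by SOME and \<open>holonomy_map\<close> by THE,
  so the explicit formula alone does not determine the holonomy. Two rigidity facts complete it: the
  metric is unique up to a factor, which the holonomy ignores, and the holonomy along a given path
  is unique, since two continuations have a quotient that is locally holomorphic of modulus 1.
  Multivalued powers never appear: around each loop lies a convex strip free of zeros of theta,
  where a logarithm exists. The holonomy jumps when \<open>z\<^sub>2\<close> crosses a loop, so
  continuity of \<open>holonomy_map\<close> cannot be used to find the leaves. What is continuous is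
  \<open>Tor_Xi\<close>; equal holonomies force its values to differ by integer vectors, and so it
  is constant on every connected part of a level set.\<close>

text \<open>\<open>qpoch q w\<close> is the product of the \<open>1 - q\<^sup>n w\<close>; the coefficients of its expansion are determined by the
  functional equation \<open>A(w) = (1 - w) A(q w)\<close>.\<close>

definition qpoch_coeff :: "complex \<Rightarrow> nat \<Rightarrow> complex" where
  "qpoch_coeff q n = (\<Prod>k<n. - (q ^ k) / (1 - q ^ Suc k))"

definition qpoch :: "complex \<Rightarrow> complex \<Rightarrow> complex" where
  "qpoch q w = (\<Sum>n. qpoch_coeff q n * w ^ n)"

lemma one_minus_power_nz:
  fixes q :: complex
  assumes "norm q < 1"
  shows "1 - q ^ Suc k \<noteq> 0"
proof
  assume "1 - q ^ Suc k = 0"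
  then have "norm (q ^ Suc k) = 1" by simp
  moreover have "norm (q ^ Suc k) < 1"
    using assms mult_left_le[of "norm q ^ k" "norm q"]
    by (simp add: norm_mult norm_power power_le_one)
  ultimately show False by simp
qed

text \<open>Consecutive terms have ratio at most |q|^n |w| / (1 - |q|), which tends to 0; so the
  series converges for every w, and \<open>qpoch q\<close> is entire.\<close>

lemma summable_qpoch:
  assumes "norm q < 1"
  shows "summable (\<lambda>n. qpoch_coeff q n * w ^ n)"
proof -
  have "(\<lambda>n. norm q ^ n * (norm w / (1 - norm q))) \<longlonglongrightarrow> 0 * (norm w / (1 - norm q))"
    by (intro tendsto_mult tendsto_const LIMSEQ_power_zero) (use assms in auto)
  then have "eventually (\<lambda>n. norm q ^ n * (norm w / (1 - norm q)) < 1/2) sequentially"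
    by (intro order_tendstoD) auto
  then obtain N where N: "\<And>n. n \<ge> N \<Longrightarrow> norm q ^ n * (norm w / (1 - norm q)) < 1/2"
    by (auto simp: eventually_sequentially)
  show ?thesis
  proof (rule summable_ratio_test[of "1/2" N])
    fix n assume n: "n \<ge> N"
    have "norm (q ^ Suc n) \<le> norm q"
      using assms mult_left_le[of "norm q ^ n" "norm q"]
      by (simp add: norm_mult norm_power power_le_one)
    then have lb: "1 - norm q \<le> norm (1 - q ^ Suc n)"
      using norm_triangle_ineq2[of 1 "q ^ Suc n"] by simp
    have "norm (- (q ^ n) / (1 - q ^ Suc n) * w) \<le> norm q ^ n * (norm w / (1 - norm q))"
      using lb assms by (simp add: norm_mult norm_divide norm_power) (auto intro!: divide_left_mono mult_nonneg_nonneg mult_pos_pos)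
    also have "\<dots> \<le> 1/2" using N[OF n] by simp
    finally have r: "norm (- (q ^ n) / (1 - q ^ Suc n) * w) \<le> 1/2" .
    have "qpoch_coeff q (Suc n) * w ^ Suc n
        = (- (q ^ n) / (1 - q ^ Suc n) * w) * (qpoch_coeff q n * w ^ n)"
      by (simp add: qpoch_coeff_def)
    then have "norm (qpoch_coeff q (Suc n) * w ^ Suc n)
        = norm (- (q ^ n) / (1 - q ^ Suc n) * w) * norm (qpoch_coeff q n * w ^ n)"
      by (simp only: norm_mult)
    also have "\<dots> \<le> 1/2 * norm (qpoch_coeff q n * w ^ n)"
      by (intro mult_right_mono r) auto
    finally show "norm (qpoch_coeff q (Suc n) * w ^ Suc n) \<le> 1/2 * norm (qpoch_coeff q n * w ^ n)" .
  qed simp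
qed

lemma holomorphic_qpoch:
  assumes "norm q < 1"
  shows "qpoch q holomorphic_on UNIV"
proof -
  have "DERIV (qpoch q) x :> (\<Sum>n. diffs (qpoch_coeff q) n * x ^ n)" for x
    unfolding qpoch_def by (rule termdiffs_strong_converges_everywhere) (rule summable_qpoch[OF assms])
  then show ?thesis
    by (auto simp: holomorphic_on_open)
qed

text \<open>Comparing coefficients of w^(n+1) gives the recursion a_(n+1) (1 - q^(n+1)) = - q^n a_n
  built into \<open>qpoch_coeff\<close>; the constant terms are both 1 and are split off
  beforehand.\<close>

lemma qpoch_functional:
  assumes "norm q < 1"
  shows "qpoch q w = (1 - w) * qpoch q (q * w)"
proof -
  let ?a = "qpoch_coeff q"
  have s: "(\<lambda>n. ?a n * x ^ n) sums qpoch q x" for x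
    unfolding qpoch_def using summable_qpoch[OF assms] by (rule summable_sums)
  have s1: "(\<lambda>n. ?a (Suc n) * w ^ Suc n) sums (qpoch q w - 1)"
    using s[of w] by (subst sums_Suc_iff) (simp add: qpoch_coeff_def)
  have s2: "(\<lambda>n. ?a (Suc n) * (q * w) ^ Suc n) sums (qpoch q (q * w) - 1)"
    using s[of "q*w"] by (subst sums_Suc_iff) (simp add: qpoch_coeff_def)
  have s3: "(\<lambda>n. ?a (Suc n) * (q * w) ^ Suc n - w * (?a n * (q * w) ^ n))
      sums (qpoch q (q * w) - 1 - w * qpoch q (q * w))"
    by (intro sums_diff s2 sums_mult s)
  have "?a (Suc n) * (q * w) ^ Suc n - w * (?a n * (q * w) ^ n) = ?a (Suc n) * w ^ Suc n" for n
  proof -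
    have "?a (Suc n) * (1 - q ^ Suc n) = - (q ^ n) * ?a n"
      using one_minus_power_nz[OF assms, of n] by (simp add: qpoch_coeff_def)
    then have "?a (Suc n) * q ^ Suc n = ?a (Suc n) + q ^ n * ?a n"
      by (simp add: algebra_simps)
    then have "?a (Suc n) * q ^ Suc n * w ^ Suc n = (?a (Suc n) + q ^ n * ?a n) * w ^ Suc n"
      by simp
    then show ?thesis by (simp add: power_mult_distrib algebra_simps)
  qed
  with s3 have "(\<lambda>n. ?a (Suc n) * w ^ Suc n) sums (qpoch q (q * w) - 1 - w * qpoch q (q * w))"
    by simp
  from sums_unique2[OF this s1] show ?thesis by (simp add: algebra_simps)
qed

lemma qpoch_prod:
  assumes "norm q < 1"
  shows "qpoch q w = (\<Prod>k<n. 1 - q ^ k * w) * qpoch q (q ^ n * w)"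
proof (induction n)
  case (Suc n)
  then show ?case
    using qpoch_functional[OF assms, of "q ^ n * w"] by (simp add: mult.assoc)
qed simp

text \<open>If no factor 1 - q^k w vanishes, a zero at w propagates to all q^n w. These tend to 0,
  where the value is 1, which contradicts continuity.\<close>

lemma qpoch_eq_0_iff:
  assumes "norm q < 1"
  shows "qpoch q w = 0 \<longleftrightarrow> (\<exists>k. q ^ k * w = 1)"
proof
  assume z: "qpoch q w = 0"
  show "\<exists>k. q ^ k * w = 1"
  proof (rule ccontr)
    assume "\<nexists>k. q ^ k * w = 1"
    then have "(\<Prod>k<n. 1 - q ^ k * w) \<noteq> 0" for n
      by auto
    then have "qpoch q (q ^ n * w) = 0" for n
      using qpoch_prod[OF assms, of w n] z by simp
    moreover have "(\<lambda>n. qpoch q (q ^ n * w)) \<longlonglongrightarrow> qpoch q (0 * w)"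
    proof (rule isCont_tendsto_compose[where g = "qpoch q"])
      show "isCont (qpoch q) (0 * w)"
        using holomorphic_on_imp_continuous_on[OF holomorphic_qpoch[OF assms]]
        by (simp add: continuous_on_eq_continuous_at)
      show "(\<lambda>n. q ^ n * w) \<longlonglongrightarrow> 0 * w"
        by (intro tendsto_mult tendsto_const LIMSEQ_power_zero assms)
    qed
    ultimately have "qpoch q 0 = 0" by (simp add: LIMSEQ_const_iff)
    moreover have "qpoch q 0 = 1"
      by (simp add: qpoch_def qpoch_coeff_def powser_zero)
    ultimately show False by simp
  qed
next
  assume "\<exists>k. q ^ k * w = 1"
  then obtain k where "q ^ k * w = 1" by blast
  then have "(\<Prod>j<Suc k. 1 - q ^ j * w) = 0" by (intro prod_zero) auto
  then show "qpoch q w = 0" using qpoch_prod[OF assms, of w "Suc k"] by simp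
qed

text \<open>By the Jacobi triple product this is, up to a constant and a factor \<open>exp (\<pi>\<i>z)\<close>, the odd Jacobi theta function.\<close>

definition theta :: "complex \<Rightarrow> complex \<Rightarrow> complex" where
  "theta \<tau> z = qpoch (exp (2 * of_real pi * \<i> * \<tau>)) (exp (2 * of_real pi * \<i> * z)) *
     qpoch (exp (2 * of_real pi * \<i> * \<tau>)) (exp (2 * of_real pi * \<i> * (\<tau> - z)))"

section \<open>Zeros and quasi-periods of theta\<close>

lemma norm_nome:
  assumes "Im \<tau> > 0"
  shows "norm (exp (2 * of_real pi * \<i> * \<tau>)) < 1"
  using assms by simp

lemma holomorphic_theta:
  assumes "Im \<tau> > 0"
  shows "theta \<tau> holomorphic_on S"
proof -
  have *: "(\<lambda>z. qpoch (exp (2 * of_real pi * \<i> * \<tau>)) (g z)) holomorphic_on UNIV"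
    if "g holomorphic_on UNIV" for g
    using holomorphic_on_compose_gen[OF that holomorphic_qpoch[OF norm_nome[OF assms]]]
    by (simp add: o_def)
  then have "theta \<tau> holomorphic_on UNIV"
    unfolding theta_def[abs_def] by (intro holomorphic_on_mult *) (auto intro!: holomorphic_intros)
  then show ?thesis by (rule holomorphic_on_subset) auto
qed

lemma theta_plus_1: "theta \<tau> (z + 1) = theta \<tau> z"
proof -
  have "exp (2 * of_real pi * \<i> * (z + 1)) = exp (2 * of_real pi * \<i> * z)"
    "exp (2 * of_real pi * \<i> * (\<tau> - (z + 1))) = exp (2 * of_real pi * \<i> * (\<tau> - z))"
    using exp_plus_2pin[of "2 * of_real pi * \<i> * z" 1]
      exp_plus_2pin[of "2 * of_real pi * \<i> * (\<tau> - z)" "-1"]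
    by (simp_all add: algebra_simps)
  then show ?thesis by (simp add: theta_def)
qed

text \<open>With w = exp (2 pi i z), the shift removes the factor 1 - w from the first product and
  adds 1 - 1/w to the second; the quotient of the two is -1/w.\<close>

lemma theta_plus_tau:
  assumes "Im \<tau> > 0"
  shows "theta \<tau> (z + \<tau>) = - exp (- (2 * of_real pi * \<i> * z)) * theta \<tau> z"
proof -
  define w q where "w = exp (2 * of_real pi * \<i> * z)" and "q = exp (2 * of_real pi * \<i> * \<tau>)"
  have q: "norm q < 1" unfolding q_def using norm_nome[OF assms] .
  have w: "w \<noteq> 0" by (simp add: w_def)
  have e: "exp (2 * of_real pi * \<i> * (z + \<tau>)) = q * w"
    "exp (2 * of_real pi * \<i> * (\<tau> - z)) = q * inverse w"
    "exp (2 * of_real pi * \<i> * (\<tau> - (z + \<tau>))) = inverse w"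
    "exp (- (2 * of_real pi * \<i> * z)) = inverse w"
    by (simp_all add: w_def q_def exp_minus[symmetric] exp_add[symmetric] algebra_simps)
  have "theta \<tau> (z + \<tau>) = qpoch q (q * w) * qpoch q (inverse w)"
    by (simp add: theta_def e flip: q_def)
  also have "qpoch q (inverse w) = (1 - inverse w) * qpoch q (q * inverse w)"
    by (rule qpoch_functional[OF q])
  also have "1 - inverse w = - inverse w * (1 - w)"
    using w by (simp add: field_simps)
  finally have "theta \<tau> (z + \<tau>) = - inverse w * (((1 - w) * qpoch q (q * w)) * qpoch q (q * inverse w))"
    by (simp add: mult_ac)
  also have "(1 - w) * qpoch q (q * w) = qpoch q w"
    by (rule qpoch_functional[OF q, symmetric])
  finally show ?thesis
    unfolding theta_def[of \<tau> z] by (simp add: e flip: q_def w_def)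
qed

text \<open>The first product vanishes at m - k \<tau>, the second at (k+1) \<tau> - m, with k a
  natural number; together these exhaust the lattice.\<close>

lemma theta_eq_0_iff:
  assumes "Im \<tau> > 0"
  shows "theta \<tau> z = 0 \<longleftrightarrow> z \<in> lattice \<tau>"
proof -
  let ?e = "\<lambda>x. exp (2 * of_real pi * \<i> * x)"
  have e1: "?e x = 1 \<longleftrightarrow> (\<exists>m::int. x = of_int m)" for x
  proof -
    have "?e x = exp 0 \<longleftrightarrow> (\<exists>m::int. 2 * of_real pi * \<i> * x = 0 + of_int (2 * m) * of_real pi * \<i>)"
      unfolding exp_eq by simp
    also have "\<dots> \<longleftrightarrow> (\<exists>m::int. x = of_int m)"
      by (intro ex_cong1) (auto simp: field_simps)
    finally show ?thesis by simp
  qed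
  have 1: "?e \<tau> ^ k * ?e z = ?e (of_nat k * \<tau> + z)"
    and 2: "?e \<tau> ^ k * ?e (\<tau> - z) = ?e (of_nat (Suc k) * \<tau> - z)" for k
    by (simp_all add: exp_of_nat_mult[symmetric] exp_add[symmetric] algebra_simps)
  have "theta \<tau> z = 0 \<longleftrightarrow> (\<exists>k. \<exists>m::int. of_nat k * \<tau> + z = of_int m)
      \<or> (\<exists>k. \<exists>m::int. of_nat (Suc k) * \<tau> - z = of_int m)"
    unfolding theta_def mult_eq_0_iff qpoch_eq_0_iff[OF norm_nome[OF assms]] 1 2 e1 by blast
  also have "\<dots> \<longleftrightarrow> z \<in> lattice \<tau>"
  proof
    assume "(\<exists>k. \<exists>m::int. of_nat k * \<tau> + z = of_int m)
      \<or> (\<exists>k. \<exists>m::int. of_nat (Suc k) * \<tau> - z = of_int m)"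
    then show "z \<in> lattice \<tau>"
    proof (elim disjE exE)
      fix k and m :: int assume "of_nat k * \<tau> + z = of_int m"
      then have "z = of_int m + of_int (- int k) * \<tau>" by (simp add: algebra_simps)
      then show ?thesis unfolding lattice_def by blast
    next
      fix k and m :: int assume "of_nat (Suc k) * \<tau> - z = of_int m"
      then have "z = of_int (-m) + of_int (int (Suc k)) * \<tau>" by (simp add: algebra_simps)
      then show ?thesis unfolding lattice_def by blast
    qed
  next
    assume "z \<in> lattice \<tau>"
    then obtain m n :: int where z: "z = of_int m + of_int n * \<tau>" by (auto simp: lattice_def)
    show "(\<exists>k. \<exists>m::int. of_nat k * \<tau> + z = of_int m)
      \<or> (\<exists>k. \<exists>m::int. of_nat (Suc k) * \<tau> - z = of_int m)"
    proof (cases "n \<le> 0")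
      case True
      then have "of_nat (nat (-n)) * \<tau> + z = of_int m" using z by simp
      then show ?thesis by blast
    next
      case False
      then have "of_nat (Suc (nat (n - 1))) * \<tau> - z = of_int (-m)" using z by simp
      then show ?thesis by blast
    qed
  qed
  finally show ?thesis .
qed

text \<open>The constant s is left unspecified because it always drops out: it is a nonzero factor
  near a zero of theta, and it cancels in |theta(z) / theta(z - z2)| and in the ratio of the end
  values of a continuation.\<close>

lemma theta_plus_n_tau:
  assumes "Im \<tau> > 0"
  shows "\<exists>s. \<forall>z. theta \<tau> (z + of_int n * \<tau>) = exp (s - 2 * of_real pi * \<i> * of_int n * z) * theta \<tau> z"
proof -
  have pos: "\<exists>s. \<forall>z. theta \<tau> (z + of_nat n * \<tau>) = exp (s - 2 * of_real pi * \<i> * of_nat n * z) * theta \<tau> z" for n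
  proof (induction n)
    case 0
    show ?case by (rule exI[of _ 0]) simp
  next
    case (Suc n)
    then obtain s where s: "\<And>z. theta \<tau> (z + of_nat n * \<tau>) = exp (s - 2 * of_real pi * \<i> * of_nat n * z) * theta \<tau> z" by blast
    \<comment> \<open>The summand pi i carries the sign in \<open>theta_plus_tau\<close>; the one in
      n \<tau> comes from evaluating the linear term at z + \<tau>.\<close>
    have "theta \<tau> (z + of_nat (Suc n) * \<tau>)
      = exp ((s + pi * \<i> - 2 * of_real pi * \<i> * of_nat n * \<tau>) - 2 * of_real pi * \<i> * of_nat (Suc n) * z) * theta \<tau> z" for z
    proof -
      have "theta \<tau> (z + of_nat (Suc n) * \<tau>) = theta \<tau> ((z + \<tau>) + of_nat n * \<tau>)"
        by (simp add: algebra_simps)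
      also have "\<dots> = exp (s - 2 * of_real pi * \<i> * of_nat n * (z + \<tau>)) * (exp (pi * \<i>) * exp (- (2 * of_real pi * \<i> * z)) * theta \<tau> z)"
        by (simp only: s theta_plus_tau[OF assms]) simp
      also have "\<dots> = exp (s - 2 * of_real pi * \<i> * of_nat n * (z + \<tau>) + pi * \<i> + - (2 * of_real pi * \<i> * z)) * theta \<tau> z"
        by (simp only: exp_add mult.assoc)
      also have "s - 2 * of_real pi * \<i> * of_nat n * (z + \<tau>) + pi * \<i> + - (2 * of_real pi * \<i> * z)
         = (s + pi * \<i> - 2 * of_real pi * \<i> * of_nat n * \<tau>) - 2 * of_real pi * \<i> * of_nat (Suc n) * z"
        by (simp add: algebra_simps)
      finally show ?thesis .
    qed
    then show ?case by blast
  qed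
  show ?thesis
  proof (cases "n \<ge> 0")
    case True
    then show ?thesis using pos[of "nat n"] by simp
  next
    case False
    define m where "m = nat (-n)"
    have n: "of_int n = - (of_nat m :: complex)" using False by (simp add: m_def)
    obtain s where s: "\<And>z. theta \<tau> (z + of_nat m * \<tau>) = exp (s - 2 * of_real pi * \<i> * of_nat m * z) * theta \<tau> z"
      using pos by blast
    have "theta \<tau> (z + of_int n * \<tau>) = exp ((- s - 2 * of_real pi * \<i> * of_nat m * of_nat m * \<tau>) - 2 * of_real pi * \<i> * of_int n * z) * theta \<tau> z" for z
    proof -
      \<comment> \<open>Negative n is the positive case read backwards from y; expressing y by z in
        the linear term puts the multiple of m^2 \<tau> into the constant.\<close>
      define y where "y = z + of_int n * \<tau>"
      have z: "z = y + of_nat m * \<tau>" by (simp add: y_def n)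
      have tz: "theta \<tau> z = exp (s - 2 * of_real pi * \<i> * of_nat m * y) * theta \<tau> y"
        unfolding z by (rule s)
      have "theta \<tau> y = exp (- (s - 2 * of_real pi * \<i> * of_nat m * y)) * theta \<tau> z"
        
        by (simp only: tz mult.assoc[symmetric] exp_add[symmetric]) simp
      also have "- (s - 2 * of_real pi * \<i> * of_nat m * y) = (- s - 2 * of_real pi * \<i> * of_nat m * of_nat m * \<tau>) - 2 * of_real pi * \<i> * of_int n * z"
        by (simp add: y_def n algebra_simps)
      finally show ?thesis by (simp add: y_def)
    qed
    then show ?thesis by blast
  qed
qed

lemma theta_plus_int: "theta \<tau> (z + of_int n) = theta \<tau> z"
proof -
  have "theta \<tau> (z + of_nat n) = theta \<tau> z" for z n
    by (induction n) (simp_all add: theta_plus_1 flip: add.assoc, metis add.assoc add.commute theta_plus_1)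
  from this[of z "nat n"] this[of "z + of_int n" "nat (-n)"] show ?thesis
    by (cases "n \<ge> 0") simp_all
qed

text \<open>Simplicity of the zeros makes the exponents at the cone points exactly \<alpha> and
  -\<alpha>. The only factor vanishing at l is 1 - exp (2 pi i (z - l)), split off by
  \<open>qpoch_functional\<close>; H l is nonzero because q^(k+1) is never 1.\<close>

lemma deriv_theta_nz:
  assumes \<tau>: "Im \<tau> > 0" and "l \<in> lattice \<tau>"
  shows "deriv (theta \<tau>) l \<noteq> 0"
proof -
  let ?q = "exp (2 * of_real pi * \<i> * \<tau>)"
  obtain m n :: int where l: "l = of_int m + of_int n * \<tau>" using assms by (auto simp: lattice_def)
  obtain s where s: "\<And>z. theta \<tau> (z + of_int n * \<tau>) = exp (s - 2 * of_real pi * \<i> * of_int n * z) * theta \<tau> z"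
    using theta_plus_n_tau[OF \<tau>] by blast
  have nz: "qpoch ?q ?q \<noteq> 0"
  proof
    assume "qpoch ?q ?q = 0"
    then obtain k where k: "?q ^ k * ?q = 1" using qpoch_eq_0_iff[OF norm_nome[OF \<tau>]] by blast
    then show False using one_minus_power_nz[OF norm_nome[OF \<tau>], of k] by (simp add: mult.commute)
  qed
  define H where "H = (\<lambda>z. qpoch ?q (?q * exp (2 * of_real pi * \<i> * (z - l))) *
     qpoch ?q (exp (2 * of_real pi * \<i> * (\<tau> - (z - l)))) * exp (s - 2 * of_real pi * \<i> * of_int n * (z - l)))"
  have th: "theta \<tau> z = (1 - exp (2 * of_real pi * \<i> * (z - l))) * H z" for z
  proof -
    have "theta \<tau> z = theta \<tau> ((z - l) + of_int n * \<tau> + of_int m)" by (simp add: l)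
    also have "\<dots> = exp (s - 2 * of_real pi * \<i> * of_int n * (z - l)) * theta \<tau> (z - l)"
      by (simp only: theta_plus_int s)
    also have "\<dots> = (1 - exp (2 * of_real pi * \<i> * (z - l))) * H z"
      unfolding theta_def H_def
      by (subst qpoch_functional[OF norm_nome[OF \<tau>]]) (simp only: mult_ac)
    finally show ?thesis .
  qed
  have *: "(\<lambda>z. qpoch ?q (g z)) holomorphic_on UNIV" if "g holomorphic_on UNIV" for g
    using holomorphic_on_compose_gen[OF that holomorphic_qpoch[OF norm_nome[OF \<tau>]]] by (simp add: o_def)
  then have "H holomorphic_on UNIV"
    unfolding H_def by (intro holomorphic_on_mult *) (auto intro!: holomorphic_intros)
  then have dH: "(H has_field_derivative deriv H l) (at l)"
    by (intro holomorphic_derivI[of _ UNIV]) auto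
  have "(theta \<tau> has_field_derivative - (2 * of_real pi * \<i>) * H l) (at l)"
    unfolding th[abs_def] by (rule derivative_eq_intros dH refl)+ simp
  then have "deriv (theta \<tau>) l = - (2 * of_real pi * \<i>) * H l" by (rule DERIV_imp_deriv)
  moreover have "H l \<noteq> 0" using nz by (simp add: H_def)
  ultimately show ?thesis by simp
qed

section \<open>Cone points and developing maps\<close>

text \<open>The cone coordinate is \<open>w = (z - p) k\<^bsup>1/\<beta>\<^esup>\<close>, where \<open>k\<close> solves \<open>(\<zeta>\<^bsup>\<beta>\<^esup> k)' = \<beta> \<zeta>\<^bsup>\<beta> - 1\<^esup> h\<close>.\<close>

lemma cone_ode:
  fixes h :: "complex \<Rightarrow> complex" and \<beta> :: real
  assumes h: "h holomorphic_on ball p r" and \<beta>: "\<beta> > 0"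
  obtains k where "k holomorphic_on ball p r" "k p = h p"
    "\<And>z. z \<in> ball p r \<Longrightarrow> of_real \<beta> * h z = of_real \<beta> * k z + (z - p) * deriv k z"
proof
  define a where "a n = (deriv ^^ n) h p / fact n" for n
  define b where "b n = of_real (\<beta> / (\<beta> + real n)) * a n" for n
  define k where "k z = (\<Sum>n. b n * (z - p) ^ n)" for z
  have sa: "(\<lambda>n. a n * (z - p) ^ n) sums h z" if "z \<in> ball p r" for z
    unfolding a_def by (rule holomorphic_power_series[OF h that])
  have nb: "norm (b n * x) \<le> norm (a n * x)" for n and x :: complex
  proof -
    have "norm (b n) = \<beta> / (\<beta> + real n) * norm (a n)"
      unfolding b_def norm_mult norm_of_real using \<beta> by simp
    also have "\<dots> \<le> 1 * norm (a n)"
      using \<beta> by (intro mult_right_mono) auto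
    finally show ?thesis by (simp add: norm_mult mult_right_mono)
  qed
  have ssa: "summable (\<lambda>n. norm (a n * x ^ n))" if x: "norm x < r" for x
  proof -
    obtain y where y: "norm x < y" "y < r" using dense[OF x] by blast
    then have "0 < y" by (meson norm_ge_zero order_le_less_trans)
    then have "summable (\<lambda>n. a n * ((p + of_real y) - p) ^ n)"
      using sa[of "p + of_real y"] y by (intro sums_summable) (auto simp: dist_norm)
    then show ?thesis
      by (intro powser_insidea[of a "of_real y"]) (use y \<open>0 < y\<close> in auto)
  qed
  have ssb: "summable (\<lambda>n. b n * x ^ n)" if "norm x < r" for x
    by (rule summable_comparison_test'[OF ssa[OF that], of 0]) (rule nb)
  have dk: "(k has_field_derivative (\<Sum>n. diffs b n * (z - p) ^ n)) (at z)"
    if "z \<in> ball p r" for z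
  proof -
    have "((\<lambda>x. \<Sum>n. b n * x ^ n) has_field_derivative (\<Sum>n. diffs b n * (z - p) ^ n)) (at (z - p))"
      by (rule termdiffs_strong'[of r]) (use ssb that in \<open>auto simp: dist_norm norm_minus_commute\<close>)
    from DERIV_chain2[where f = "\<lambda>x. \<Sum>n. b n * x ^ n" and g = "\<lambda>z. z - p", OF this, of 1 UNIV] show ?thesis
      unfolding k_def[abs_def] by (simp add: DERIV_ident DERIV_diff[OF DERIV_ident DERIV_const, simplified])
  qed
  show "k holomorphic_on ball p r" using dk unfolding holomorphic_on_open[OF open_ball] by blast
  show "of_real \<beta> * h z = of_real \<beta> * k z + (z - p) * deriv k z" if z: "z \<in> ball p r" for z
  proof -
    let ?x = "z - p"
    have nx: "norm ?x < r" using z by (simp add: dist_norm norm_minus_commute)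
    have sb: "(\<lambda>n. b n * ?x ^ n) sums k z" unfolding k_def using ssb[OF nx] by (rule summable_sums)
    have "summable (\<lambda>n. diffs b n * ?x ^ n)"
      by (rule termdiff_converges[OF nx]) (rule ssb)
    then have "(\<lambda>n. diffs b n * ?x ^ n) sums deriv k z"
      using DERIV_imp_deriv[OF dk[OF z]] by (simp add: summable_sums)
    then have "(\<lambda>n. ?x * (diffs b n * ?x ^ n)) sums (?x * deriv k z)" by (rule sums_mult)
    then have "(\<lambda>n. of_nat (Suc n) * b (Suc n) * ?x ^ Suc n) sums (?x * deriv k z - of_nat 0 * b 0 * ?x ^ 0)"
      by (simp add: diffs_def mult_ac)
    then have "(\<lambda>n. of_nat n * b n * ?x ^ n) sums (?x * deriv k z)"
      by (subst (asm) sums_Suc_iff) simp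
    then have "(\<lambda>n. of_real \<beta> * (b n * ?x ^ n) + of_nat n * b n * ?x ^ n) sums (of_real \<beta> * k z + ?x * deriv k z)"
      by (intro sums_add sums_mult sb)
    moreover have "of_real \<beta> * (b n * ?x ^ n) + of_nat n * b n * ?x ^ n = of_real \<beta> * (a n * ?x ^ n)" for n
    proof -
      have "of_real \<beta> * b n + of_nat n * b n = of_real ((\<beta> + real n) * (\<beta> / (\<beta> + real n))) * a n"
        unfolding b_def by (simp only: of_real_mult of_real_add of_real_of_nat_eq algebra_simps)
      also have "\<dots> = of_real \<beta> * a n" using \<beta> by simp
      finally have "(of_real \<beta> * b n + of_nat n * b n) * ?x ^ n = of_real \<beta> * a n * ?x ^ n" by simp
      then show ?thesis by (simp add: algebra_simps)
    qed
    ultimately have "(\<lambda>n. of_real \<beta> * (a n * ?x ^ n)) sums (of_real \<beta> * k z + ?x * deriv k z)" by simp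
    then show ?thesis using sums_mult[OF sa[OF z], of "of_real \<beta>"] sums_unique2 by blast
  qed
  show "k p = h p"
  proof -
    have "k p = b 0" by (simp add: k_def powser_zero)
    also have "\<dots> = h p" using \<beta> by (simp add: b_def a_def)
    finally show ?thesis .
  qed
qed

text \<open>With w^\<beta> = (z - p)^\<beta> k, differentiation and the equation for k give
  w^\<alpha> w' = (z - p)^\<alpha> h; the moduli of the two sides are the cone condition.\<close>

lemma cone_coordinate:
  fixes h :: "complex \<Rightarrow> complex" and \<alpha> :: real
  assumes h: "h holomorphic_on ball p r" and r: "r > 0" and nz: "h p \<noteq> 0" and \<alpha>: "\<alpha> > -1"
    and \<phi>: "\<And>z. z \<in> ball p r - {p} \<Longrightarrow> \<phi> z = cmod (z - p) powr \<alpha> * cmod (h z)"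
  shows "has_cone_angle \<phi> p (2 * pi * (1 + \<alpha>))"
proof -
  define \<beta> where "\<beta> = 1 + \<alpha>"
  have \<beta>: "\<beta> > 0" using \<alpha> by (simp add: \<beta>_def)
  obtain k where k: "k holomorphic_on ball p r" "k p = h p"
    "\<And>z. z \<in> ball p r \<Longrightarrow> of_real \<beta> * h z = of_real \<beta> * k z + (z - p) * deriv k z"
    using cone_ode[OF h \<beta>] by blast
  have "continuous_on (ball p r) k" using k(1) by (rule holomorphic_on_imp_continuous_on)
  then have "\<exists>e>0. \<forall>y. dist p y < e \<longrightarrow> k y \<noteq> 0"
    using r nz k(2) by (intro continuous_on_open_avoid[of "ball p r"]) auto
  then obtain e where e: "e > 0" "\<And>y. dist p y < e \<Longrightarrow> k y \<noteq> 0" by blast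
  define s where "s = min r e"
  have s: "s > 0" "ball p s \<subseteq> ball p r" "\<And>y. y \<in> ball p s \<Longrightarrow> k y \<noteq> 0"
    using r e by (auto simp: s_def)
  \<comment> \<open>On the smaller ball k has no zeros, so k^(1/\<beta>) can be taken as exp (L /
    \<beta>).\<close>
  have ks: "k holomorphic_on ball p s" using k(1) s(2) by (rule holomorphic_on_subset)
  obtain L where L: "L holomorphic_on ball p s" "\<And>x. x \<in> ball p s \<Longrightarrow> exp (L x) = k x"
    using holomorphic_logarithm_exists[OF convex_ball open_ball ks s(3), of p] s(1) by auto
  define w where "w z = (z - p) * exp (L z / of_real \<beta>)" for z
  have w: "w holomorphic_on ball p s"
    unfolding w_def using L(1) \<beta> by (intro holomorphic_intros) auto
  have dw: "deriv w z = exp (L z / of_real \<beta>) * h z / k z" if z: "z \<in> ball p s" for z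
  proof -
    have dL: "(L has_field_derivative deriv L z) (at z)"
      using L(1) z by (intro holomorphic_derivI) auto
    have "(k has_field_derivative exp (L z) * deriv L z) (at z)"
    proof (rule has_field_derivative_transform_within_open[of "\<lambda>z. exp (L z)" _ _ "ball p s"])
      show "((\<lambda>z. exp (L z)) has_field_derivative exp (L z) * deriv L z) (at z)"
        by (rule derivative_eq_intros dL refl)+
    qed (use z L in auto)
    then have dk: "deriv k z = k z * deriv L z" using L(2)[OF z] by (simp add: DERIV_imp_deriv)
    have "(w has_field_derivative exp (L z / of_real \<beta>) + (z - p) * (exp (L z / of_real \<beta>) * (deriv L z / of_real \<beta>))) (at z)"
      unfolding w_def using \<beta> by (auto intro!: derivative_eq_intros dL)
    then have "deriv w z = exp (L z / of_real \<beta>) * (1 + (z - p) * deriv L z / of_real \<beta>)"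
      by (simp add: DERIV_imp_deriv algebra_simps)
    also have "1 + (z - p) * deriv L z / of_real \<beta> = h z / k z"
    proof -
      have "of_real \<beta> * h z = of_real \<beta> * k z + (z - p) * deriv k z"
        using k(3) z s(2) by blast
      also have "\<dots> = k z * (of_real \<beta> + (z - p) * deriv L z)" by (simp add: dk algebra_simps)
      finally have "h z = k z * (of_real \<beta> + (z - p) * deriv L z) / of_real \<beta>"
        using \<beta> by (simp add: field_simps)
      then show ?thesis using \<beta> s(3)[OF z] by (simp add: field_simps)
    qed
    finally show ?thesis by simp
  qed
  \<comment> \<open>At p the quotient h / k is 1, so the derivative is exp (L p / \<beta>), and w
    becomes injective after one more shrinking.\<close>
  have "deriv w p \<noteq> 0" using dw[of p] s nz k(2) by auto
  then obtain t where t: "t > 0" "ball p t \<subseteq> ball p s" "inj_on w (ball p t)"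
    using has_complex_derivative_locally_injective[OF w, of p] s(1) by auto
  show ?thesis
    unfolding has_cone_angle_def
  proof (intro exI[of _ "ball p t"] exI[of _ w] conjI ballI)
    fix z assume z: "z \<in> ball p t - {p}"
    then have zs: "z \<in> ball p s" and zr: "z \<in> ball p r - {p}" using t(2) s(2) by blast+
    have "cmod (w z) powr \<alpha> * cmod (deriv w z)
        = cmod (z - p) powr \<alpha> * (exp (Re (L z) / \<beta>) powr \<alpha> * exp (Re (L z) / \<beta>)) * cmod (h z) / cmod (k z)"
      by (simp add: dw[OF zs] w_def norm_mult norm_divide powr_mult)
    also have "exp (Re (L z) / \<beta>) powr \<alpha> * exp (Re (L z) / \<beta>) = exp (Re (L z) / \<beta> * (\<alpha> + 1))"
      by (simp add: exp_powr_real exp_add[symmetric] algebra_simps add_divide_distrib)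
    also have "\<alpha> + 1 = \<beta>" by (simp add: \<beta>_def)
    also have "Re (L z) / \<beta> * \<beta> = Re (L z)" using \<beta> by simp
    also have "exp (Re (L z)) = cmod (k z)" by (simp flip: L(2)[OF zs])
    finally have "cmod (w z) powr \<alpha> * cmod (deriv w z) = cmod (z - p) powr \<alpha> * cmod (h z)"
      using s(3)[OF zs] by simp
    then show "\<phi> z = cmod (w z) powr (2 * pi * (1 + \<alpha>) / (2 * pi) - 1) * cmod (deriv w z)"
      using \<phi>[OF zr] by simp
  qed (use t w in \<open>auto simp: w_def intro: holomorphic_on_subset\<close>)
qed

text \<open>Here w = (z - p) v with v free of zeros by injectivity of w, so v^\<alpha> w' can be
  absorbed into H. This exposes the exponent at p, which then cancels in a ratio of two
  metrics.\<close>

lemma cone_angle_local_form: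
  assumes "has_cone_angle \<phi> p (2 * pi * (1 + \<alpha>))"
  obtains r H where "r > 0" "H holomorphic_on ball p r" "\<And>z. z \<in> ball p r \<Longrightarrow> H z \<noteq> 0"
    "\<And>z. z \<in> ball p r - {p} \<Longrightarrow> \<phi> z = cmod (z - p) powr \<alpha> * cmod (H z)"
proof -
  obtain U w where U: "open U" "p \<in> U" and w: "w holomorphic_on U" "inj_on w U" "w p = 0"
    and \<phi>: "\<And>z. z \<in> U - {p} \<Longrightarrow> \<phi> z = cmod (w z) powr \<alpha> * cmod (deriv w z)"
    using assms by (auto simp: has_cone_angle_def)
  obtain r where r: "r > 0" "ball p r \<subseteq> U" using U by (meson open_contains_ball)
  define v where "v z = (if z = p then deriv w p else (w z - w p) / (z - p))" for z
  have w': "w holomorphic_on ball p r" "inj_on w (ball p r)"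
    using w r by (auto intro: holomorphic_on_subset inj_on_subset)
  have v: "v holomorphic_on ball p r"
    unfolding v_def[abs_def] using w'(1) open_ball by (rule pole_lemma_open)
  have dw: "deriv w z \<noteq> 0" if "z \<in> ball p r" for z
    using holomorphic_injective_imp_regular[OF w'(1) open_ball w'(2) that] .
  have vnz: "v z \<noteq> 0" if "z \<in> ball p r" for z
    using dw r inj_onD[OF w'(2), of z p] that by (auto simp: v_def)
  obtain L where L: "L holomorphic_on ball p r" "\<And>x. x \<in> ball p r \<Longrightarrow> exp (L x) = v x"
    using holomorphic_logarithm_exists[OF convex_ball open_ball v vnz, of p] r(1) by auto
  show thesis
  proof (rule that[of r "\<lambda>z. exp (of_real \<alpha> * L z) * deriv w z"])
    show "(\<lambda>z. exp (of_real \<alpha> * L z) * deriv w z) holomorphic_on ball p r"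
      using L(1) w'(1) by (intro holomorphic_intros) auto
    fix z assume z: "z \<in> ball p r - {p}"
    have "w z = (z - p) * v z" using z w(3) by (simp add: v_def)
    then have "cmod (w z) powr \<alpha> = cmod (z - p) powr \<alpha> * exp (Re (L z)) powr \<alpha>"
      using L(2)[of z] z by (simp add: norm_mult powr_mult flip: norm_exp_eq_Re)
    then show "\<phi> z = cmod (z - p) powr \<alpha> * cmod (exp (of_real \<alpha> * L z) * deriv w z)"
      using \<phi>[of z] z r by (simp add: subset_iff norm_mult exp_powr_real mult.commute)
  qed (use r dw in auto)
qed

lemma developing_map_exists:
  assumes "open U" "convex U" "G holomorphic_on U" "\<And>z. z \<in> U \<Longrightarrow> G z \<noteq> 0"
    "\<And>z. z \<in> U \<Longrightarrow> \<phi> z = cmod (G z)"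
  obtains f where "developing_map \<phi> U f" "\<And>z. z \<in> U \<Longrightarrow> deriv f z = G z"
proof -
  obtain f where f: "\<And>x. x \<in> U \<Longrightarrow> (f has_field_derivative G x) (at x within U)"
    using holomorphic_convex_primitive'[OF assms(2,1,3)] by blast
  have "(f has_field_derivative G x) (at x)" if "x \<in> U" for x
    using f[OF that] at_within_open[OF that assms(1)] by simp
  then have "deriv f z = G z" "f field_differentiable (at z)" if "z \<in> U" for z
    using that by (auto simp: DERIV_imp_deriv field_differentiable_def)
  then show thesis
    using assms by (intro that[of f])
      (auto simp: developing_map_def holomorphic_on_def field_differentiable_at_within)
qed

text \<open>One primitive of G on the convex set develops the metric along the whole path, so the
  radius \<delta> is arbitrary.\<close>

lemma linear_holonomy_exists:
  assumes "open U" "convex U" "G holomorphic_on U" "\<And>z. z \<in> U \<Longrightarrow> G z \<noteq> 0"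
    "\<And>z. z \<in> U \<Longrightarrow> \<phi> z = cmod (G z)" and "\<gamma> ` {0..1} \<subseteq> U"
  shows "has_linear_holonomy \<phi> \<gamma> (G (\<gamma> 1) / G (\<gamma> 0))"
proof -
  obtain f where f: "developing_map \<phi> U f" "\<And>z. z \<in> U \<Longrightarrow> deriv f z = G z"
    using developing_map_exists[OF assms(1-5)] by blast
  show ?thesis
    unfolding has_linear_holonomy_def
  proof (intro exI[of _ "G \<circ> \<gamma>"] conjI ballI)
    fix t :: real
    show "\<exists>U f \<delta>. developing_map \<phi> U f \<and> \<delta> > 0 \<and>
              (\<forall>s\<in>{0..1}. \<bar>s - t\<bar> < \<delta> \<longrightarrow> \<gamma> s \<in> U \<and> (G \<circ> \<gamma>) s = deriv f (\<gamma> s))"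
      using assms(6) f by (intro exI[of _ U] exI[of _ f] exI[of _ "1::real"]) auto
  qed simp
qed

section \<open>Rigidity of the linear holonomy\<close>

lemma holomorphic_norm_const:
  assumes "q holomorphic_on ball a r" "\<And>z. z \<in> ball a r \<Longrightarrow> cmod (q z) = 1" "z \<in> ball a r"
  shows "q z = q a"
proof -
  have r: "r > 0" using assms(3) by (simp add: order_le_less_trans[OF zero_le_dist])
  have "q constant_on ball a r"
    by (rule maximum_modulus_principle[OF assms(1), of "ball a r" a]) (use assms(2) r in auto)
  then show ?thesis using assms(3) r by (auto simp: constant_on_def)
qed

text \<open>The quotient of the two continuations is locally constant on [0,1], hence equal at both
  ends. Their nonvanishing is carried along because the end values are cross-multiplied.\<close>

lemma linear_holonomy_unique:
  assumes \<gamma>: "continuous_on {0..1} \<gamma>"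
    and "has_linear_holonomy \<phi> \<gamma> \<zeta>" "has_linear_holonomy \<phi> \<gamma> \<zeta>'"
  shows "\<zeta> = \<zeta>'"
proof -
  obtain g where g: "\<And>t. t \<in> {0..1} \<Longrightarrow> \<exists>U f \<delta>. developing_map \<phi> U f \<and> \<delta> > 0 \<and>
              (\<forall>s\<in>{0..1}. \<bar>s - t\<bar> < \<delta> \<longrightarrow> \<gamma> s \<in> U \<and> g s = deriv f (\<gamma> s))" "\<zeta> = g 1 / g 0"
    using assms(2) unfolding has_linear_holonomy_def by blast
  obtain g' where g': "\<And>t. t \<in> {0..1} \<Longrightarrow> \<exists>U f \<delta>. developing_map \<phi> U f \<and> \<delta> > 0 \<and>
              (\<forall>s\<in>{0..1}. \<bar>s - t\<bar> < \<delta> \<longrightarrow> \<gamma> s \<in> U \<and> g' s = deriv f (\<gamma> s))" "\<zeta>' = g' 1 / g' 0"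
    using assms(3) unfolding has_linear_holonomy_def by blast
  have loc: "\<exists>d>0. \<forall>s\<in>{0..1}. \<bar>s - t\<bar> < d \<longrightarrow> g s \<noteq> 0 \<and> g' s \<noteq> 0 \<and> g s / g' s = g t / g' t"
    if t: "t \<in> {0..1}" for t
  proof -
    obtain U f \<delta> where 1: "developing_map \<phi> U f" "\<delta> > 0"
      "\<And>s. s\<in>{0..1} \<Longrightarrow> \<bar>s - t\<bar> < \<delta> \<Longrightarrow> \<gamma> s \<in> U \<and> g s = deriv f (\<gamma> s)" using g(1)[OF t] by blast
    obtain U' f' \<delta>' where 2: "developing_map \<phi> U' f'" "\<delta>' > 0"
      "\<And>s. s\<in>{0..1} \<Longrightarrow> \<bar>s - t\<bar> < \<delta>' \<Longrightarrow> \<gamma> s \<in> U' \<and> g' s = deriv f' (\<gamma> s)" using g'(1)[OF t] by blast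
    have o: "open (U \<inter> U')" "\<gamma> t \<in> U \<inter> U'"
      using 1(1,2) 2(1,2) 1(3)[OF t] 2(3)[OF t] by (auto simp: developing_map_def)
    then obtain e where e: "e > 0" "ball (\<gamma> t) e \<subseteq> U \<inter> U'" by (meson open_contains_ball)
    obtain \<eta> where \<eta>: "\<eta> > 0" "\<And>s. s \<in> {0..1} \<Longrightarrow> dist s t < \<eta> \<Longrightarrow> dist (\<gamma> s) (\<gamma> t) < e"
      using \<gamma>[unfolded continuous_on_iff, rule_format, OF t e(1)] by blast
    let ?q = "\<lambda>z. deriv f z / deriv f' z"
    have q: "?q holomorphic_on ball (\<gamma> t) e"
      using 1(1) 2(1) e(2) unfolding developing_map_def
      by (intro holomorphic_intros) (auto intro: holomorphic_on_subset)
    have n: "cmod (?q z) = 1" if "z \<in> ball (\<gamma> t) e" for z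
    proof -
      have "z \<in> U" "z \<in> U'" using that e(2) by auto
      then have "deriv f' z \<noteq> 0" "cmod (deriv f z) = cmod (deriv f' z)"
        using 1(1) 2(1) unfolding developing_map_def by metis+
      then show ?thesis by (simp add: norm_divide)
    qed
    show ?thesis
    \<comment> \<open>\<eta> keeps \<gamma> s in the ball where the quotient is constant; the other
      two radii keep both local formulas valid.\<close>
    proof (intro exI[of _ "min \<eta> (min \<delta> \<delta>')"] conjI ballI impI)
      fix s assume s: "s \<in> {0..1}" "\<bar>s - t\<bar> < min \<eta> (min \<delta> \<delta>')"
      have b: "\<gamma> s \<in> ball (\<gamma> t) e" using \<eta>(2)[OF s(1)] s(2) by (simp add: dist_real_def dist_commute)
      have gs: "\<gamma> s \<in> U" "g s = deriv f (\<gamma> s)" "\<gamma> s \<in> U'" "g' s = deriv f' (\<gamma> s)"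
        using 1(3)[OF s(1)] 2(3)[OF s(1)] s(2) by auto
      show "g s \<noteq> 0" "g' s \<noteq> 0"
        using 1(1) 2(1) gs unfolding developing_map_def by simp_all
      have "?q (\<gamma> s) = ?q (\<gamma> t)" by (rule holomorphic_norm_const[OF q n b])
      then show "g s / g' s = g t / g' t"
        using gs(2,4) 1(3)[OF t] 2(3)[OF t] 1(2) 2(2) by simp
    qed (use \<eta>(1) 1(2) 2(2) in auto)
  qed
  have "(\<lambda>s. g s / g' s) constant_on {0..1}"
  proof (rule locally_constant_imp_constant[OF connected_Icc])
    fix t :: real assume t: "t \<in> {0..1}"
    obtain d where d: "d > 0" "\<And>s. s \<in> {0..1} \<Longrightarrow> \<bar>s - t\<bar> < d \<Longrightarrow> g s / g' s = g t / g' t"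
      using loc[OF t] by blast
    have "\<bar>x - t\<bar> < d" if "x \<in> ball t d" for x
      using that by (simp add: dist_real_def abs_minus_commute)
    then have "\<forall>x\<in>{0..1} \<inter> ball t d. g x / g' x = g t / g' t" using d(2) by blast
    moreover have "openin (top_of_set {0..1}) ({0..1} \<inter> ball t d)" by (simp add: openin_open_Int)
    moreover have "t \<in> {0..1} \<inter> ball t d" using t d(1) by simp
    ultimately show "\<exists>T. openin (top_of_set {0..1}) T \<and> t \<in> T \<and> (\<forall>x\<in>T. g x / g' x = g t / g' t)"
      by blast
  qed
  then have "g 1 / g' 1 = g 0 / g' 0" unfolding constant_on_def by auto
  moreover have "g s \<noteq> 0 \<and> g' s \<noteq> 0" if s: "s \<in> {0..1}" for s
  proof -
    obtain d where "d > 0" "\<And>r. r \<in> {0..1} \<Longrightarrow> \<bar>r - s\<bar> < d \<Longrightarrow> g r \<noteq> 0 \<and> g' r \<noteq> 0"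
      using loc[OF s] by blast
    then show ?thesis using s by simp
  qed
  from this[of 0] this[of 1] have "g 0 \<noteq> 0" "g 1 \<noteq> 0" "g' 0 \<noteq> 0" "g' 1 \<noteq> 0" by auto
  ultimately show ?thesis unfolding g(2) g'(2) by (simp add: frac_eq_eq mult.commute)
qed

section \<open>Existence and uniqueness of the flat metric\<close>

lemma lattice_add: "x \<in> lattice \<tau> \<Longrightarrow> y \<in> lattice \<tau> \<Longrightarrow> x + y \<in> lattice \<tau>"
proof -
  assume "x \<in> lattice \<tau>" "y \<in> lattice \<tau>"
  then obtain m n m' n' where "x = of_int m + of_int n * \<tau>" "y = of_int m' + of_int n' * \<tau>"
    by (auto simp: lattice_def)
  then have "x + y = of_int (m + m') + of_int (n + n') * \<tau>" by (simp add: algebra_simps)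
  then show ?thesis unfolding lattice_def by blast
qed

lemma lattice_uminus: "x \<in> lattice \<tau> \<Longrightarrow> - x \<in> lattice \<tau>"
proof -
  assume "x \<in> lattice \<tau>"
  then obtain m n where "x = of_int m + of_int n * \<tau>" by (auto simp: lattice_def)
  then have "- x = of_int (- m) + of_int (- n) * \<tau>" by simp
  then show ?thesis unfolding lattice_def by blast
qed

lemma cone_points_iff:
  assumes "Im \<tau> > 0"
  shows "z \<in> cone_points \<tau> z\<^sub>2 \<longleftrightarrow> theta \<tau> z * theta \<tau> (z - z\<^sub>2) = 0"
proof -
  have "z \<in> (+) z\<^sub>2 ` lattice \<tau> \<longleftrightarrow> z - z\<^sub>2 \<in> lattice \<tau>"
    by (metis add.commute diff_add_cancel image_iff add_diff_cancel_left')
  then show ?thesis by (simp add: cone_points_def theta_eq_0_iff[OF assms])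
qed

lemma holomorphic_nonzero_ball:
  fixes f :: "complex \<Rightarrow> complex"
  assumes "f holomorphic_on UNIV" "f p \<noteq> 0"
  obtains r where "r > 0" "\<And>z. z \<in> ball p r \<Longrightarrow> f z \<noteq> 0"
  using continuous_on_open_avoid[OF holomorphic_on_imp_continuous_on[OF assms(1)] open_UNIV, of p 0]
    assms(2) that by auto

lemma holomorphic_shift:
  assumes "f holomorphic_on UNIV"
  shows "(\<lambda>z. f (z - a)) holomorphic_on S"
proof -
  have "(\<lambda>z. z - a) holomorphic_on S" by (intro holomorphic_intros)
  from holomorphic_on_compose_gen[OF this assms] show ?thesis by (simp add: o_def)
qed

lemma holomorphic_theta_shift:
  assumes "Im \<tau> > 0"
  shows "(\<lambda>z. theta \<tau> (z - a)) holomorphic_on S"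
  by (rule holomorphic_shift[OF holomorphic_theta[OF assms]])

lemma theta_factor:
  assumes \<tau>: "Im \<tau> > 0" and l: "l \<in> lattice \<tau>"
  obtains v where "v holomorphic_on UNIV" "v l \<noteq> 0" "\<And>z. theta \<tau> z = (z - l) * v z"
proof
  let ?v = "\<lambda>z. if z = l then deriv (theta \<tau>) l else (theta \<tau> z - theta \<tau> l) / (z - l)"
  show "?v holomorphic_on UNIV" by (rule pole_lemma_open[OF holomorphic_theta[OF \<tau>] open_UNIV])
  show "?v l \<noteq> 0" using deriv_theta_nz[OF assms] by simp
  show "theta \<tau> z = (z - l) * ?v z" for z
    using l theta_eq_0_iff[OF \<tau>, of l] by simp
qed

text \<open>E is exp (\<alpha> log f), and convexity supplies the logarithm. This turns each factor
  of the density into the modulus of a holomorphic function.\<close>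

lemma holomorphic_norm_powr:
  fixes f :: "complex \<Rightarrow> complex" and \<alpha> :: real
  assumes "open U" "convex U" "f holomorphic_on U" "\<And>z. z \<in> U \<Longrightarrow> f z \<noteq> 0"
  obtains E where "E holomorphic_on U" "\<And>z. E z \<noteq> 0" "\<And>z. z \<in> U \<Longrightarrow> cmod (E z) = cmod (f z) powr \<alpha>"
proof (cases "U = {}")
  case True
  then show ?thesis using that[of "\<lambda>_. 1"] by auto
next
  case False
  then obtain L where L: "L holomorphic_on U" "\<And>x. x \<in> U \<Longrightarrow> exp (L x) = f x"
    using holomorphic_logarithm_exists[OF assms(2,1,3,4)] by blast
  show ?thesis
  proof (rule that[of "\<lambda>z. exp (of_real \<alpha> * L z)"])
    show "(\<lambda>z. exp (of_real \<alpha> * L z)) holomorphic_on U" using L(1) by (intro holomorphic_intros)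
    show "cmod (exp (of_real \<alpha> * L z)) = cmod (f z) powr \<alpha>" if "z \<in> U" for z
      by (simp add: exp_powr_real mult.commute flip: L(2)[OF that])
  qed simp
qed

text \<open>Under z + \<tau> the factor |theta(z) / theta(z - z2)|^\<alpha> grows by exp (2 pi
  \<alpha> Im z2). The rate c is purely imaginary, so that |exp (c z)| has period 1, and its size
  makes |exp (c \<tau>)| the reciprocal of that growth.\<close>

definition flat_rate :: "real \<Rightarrow> complex \<Rightarrow> complex \<Rightarrow> complex" where
  "flat_rate \<alpha> \<tau> z\<^sub>2 = 2 * of_real pi * \<i> * of_real (\<alpha> * (Im z\<^sub>2 / Im \<tau>))"

definition flat_density :: "real \<Rightarrow> complex \<Rightarrow> complex \<Rightarrow> complex \<Rightarrow> real" where
  "flat_density \<alpha> \<tau> z\<^sub>2 z = cmod (exp (flat_rate \<alpha> \<tau> z\<^sub>2 * z)) *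
     cmod (theta \<tau> z) powr \<alpha> * cmod (theta \<tau> (z - z\<^sub>2)) powr (- \<alpha>)"

lemma flat_density_periodic:
  assumes \<tau>: "Im \<tau> > 0" and "l \<in> lattice \<tau>"
  shows "flat_density \<alpha> \<tau> z\<^sub>2 (z + l) = flat_density \<alpha> \<tau> z\<^sub>2 z"
proof -
  obtain m n :: int where l: "l = of_int n * \<tau> + of_int m"
    using assms by (auto simp: lattice_def add.commute)
  obtain s where s: "\<And>z. theta \<tau> (z + of_int n * \<tau>) = exp (s - 2 * of_real pi * \<i> * of_int n * z) * theta \<tau> z"
    using theta_plus_n_tau[OF \<tau>] by blast
  \<comment> \<open>u is the logarithm of the growth of |theta| under translation by l; in the end
    only u z - u (z - z2) = 2 pi n Im z2 enters.\<close>
  define u where "u z = Re s + 2 * pi * of_int n * Im z" for z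
  have t: "cmod (theta \<tau> (z + l)) = exp (u z) * cmod (theta \<tau> z)" for z
    unfolding l add.assoc[symmetric] theta_plus_int s norm_mult norm_exp_eq_Re by (simp add: u_def)
  have t2: "cmod (theta \<tau> (z + l - z\<^sub>2)) = exp (u (z - z\<^sub>2)) * cmod (theta \<tau> (z - z\<^sub>2))"
    using t[of "z - z\<^sub>2"] by (simp add: algebra_simps)
  have c: "cmod (exp (flat_rate \<alpha> \<tau> z\<^sub>2 * (z + l))) = exp (- 2 * pi * \<alpha> * of_int n * Im z\<^sub>2) * cmod (exp (flat_rate \<alpha> \<tau> z\<^sub>2 * z))"
    using \<tau> by (simp add: l flat_rate_def exp_add[symmetric] field_simps)
  have "flat_density \<alpha> \<tau> z\<^sub>2 (z + l) = exp (- 2 * pi * \<alpha> * of_int n * Im z\<^sub>2) * exp (u z) powr \<alpha> * exp (u (z - z\<^sub>2)) powr (- \<alpha>) * flat_density \<alpha> \<tau> z\<^sub>2 z"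
    unfolding flat_density_def t t2 c by (simp add: powr_mult)
  also have "exp (- 2 * pi * \<alpha> * of_int n * Im z\<^sub>2) * exp (u z) powr \<alpha> * exp (u (z - z\<^sub>2)) powr (- \<alpha>) = 1"
    by (simp add: exp_powr_real exp_add[symmetric] u_def algebra_simps)
  finally show ?thesis by simp
qed

lemma flat_density_regular:
  assumes \<tau>: "Im \<tau> > 0" and p: "p \<notin> cone_points \<tau> z\<^sub>2"
  obtains r G where "r > 0" "G holomorphic_on ball p r" "\<And>z. z \<in> ball p r \<Longrightarrow> G z \<noteq> 0"
    "\<And>z. z \<in> ball p r \<Longrightarrow> flat_density \<alpha> \<tau> z\<^sub>2 z = cmod (G z)"
proof -
  note h = holomorphic_theta[OF \<tau>]
  note h2 = holomorphic_theta_shift[OF \<tau>, of z\<^sub>2]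
  obtain r where r: "r > 0" "\<And>z. z \<in> ball p r \<Longrightarrow> theta \<tau> z * theta \<tau> (z - z\<^sub>2) \<noteq> 0"
    using holomorphic_nonzero_ball[OF holomorphic_on_mult[OF h h2], of p] p
    unfolding cone_points_iff[OF \<tau>] by blast
  obtain E where E: "E holomorphic_on ball p r" "\<And>z. E z \<noteq> 0" "\<And>z. z \<in> ball p r \<Longrightarrow> cmod (E z) = cmod (theta \<tau> z) powr \<alpha>"
    using holomorphic_norm_powr[OF open_ball convex_ball h[of "ball p r"], of \<alpha>] r(2) by auto
  obtain F where F: "F holomorphic_on ball p r" "\<And>z. F z \<noteq> 0" "\<And>z. z \<in> ball p r \<Longrightarrow> cmod (F z) = cmod (theta \<tau> (z - z\<^sub>2)) powr (-\<alpha>)"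
    using holomorphic_norm_powr[OF open_ball convex_ball h2[of "ball p r"], of "-\<alpha>"] r(2) by auto
  show thesis
  proof (rule that[of r "\<lambda>z. exp (flat_rate \<alpha> \<tau> z\<^sub>2 * z) * E z * F z"])
    show "(\<lambda>z. exp (flat_rate \<alpha> \<tau> z\<^sub>2 * z) * E z * F z) holomorphic_on ball p r"
      using E(1) F(1) by (intro holomorphic_intros)
  qed (use r E F in \<open>auto simp: flat_density_def norm_mult\<close>)
qed

text \<open>Covers both kinds of cone point: the factor vanishing at p has exponent \<alpha>, the
  other one, nonzero at p, has exponent \<beta>. Over \<open>z\<^sub>2\<close> the exponent \<alpha>
  of this lemma is the negative one.\<close>

lemma cone_angle_of_factor:
  assumes \<alpha>: "\<alpha> > -1" and v: "v holomorphic_on UNIV" "v p \<noteq> 0" and u: "u holomorphic_on UNIV" "u p \<noteq> 0"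
    and \<phi>: "\<And>z. \<phi> z = cmod (exp (c * z)) * cmod ((z - p) * v z) powr \<alpha> * cmod (u z) powr \<beta>"
  shows "has_cone_angle \<phi> p (2 * pi * (1 + \<alpha>))"
proof -
  obtain r where r: "r > 0" "\<And>z. z \<in> ball p r \<Longrightarrow> v z * u z \<noteq> 0"
    using holomorphic_nonzero_ball[OF holomorphic_on_mult[OF v(1) u(1)], of p] v(2) u(2) by auto
  have hv: "v holomorphic_on ball p r" and hu: "u holomorphic_on ball p r"
    using v(1) u(1) by (auto intro: holomorphic_on_subset)
  obtain E where E: "E holomorphic_on ball p r" "\<And>z. E z \<noteq> 0" "\<And>z. z \<in> ball p r \<Longrightarrow> cmod (E z) = cmod (v z) powr \<alpha>"
    using holomorphic_norm_powr[OF open_ball convex_ball hv, of \<alpha>] r(2) by auto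
  obtain F where F: "F holomorphic_on ball p r" "\<And>z. F z \<noteq> 0" "\<And>z. z \<in> ball p r \<Longrightarrow> cmod (F z) = cmod (u z) powr \<beta>"
    using holomorphic_norm_powr[OF open_ball convex_ball hu, of \<beta>] r(2) by auto
  show ?thesis
  proof (rule cone_coordinate[of "\<lambda>z. exp (c * z) * E z * F z" p r])
    show "(\<lambda>z. exp (c * z) * E z * F z) holomorphic_on ball p r"
      using E(1) F(1) by (intro holomorphic_intros)
    fix z assume "z \<in> ball p r - {p}"
    then show "\<phi> z = cmod (z - p) powr \<alpha> * cmod (exp (c * z) * E z * F z)"
      using E(3) F(3) by (simp add: \<phi> norm_mult powr_mult)
  qed (use r \<alpha> E F in auto)
qed

lemma flat_cone_metric_flat_density:
  assumes \<tau>: "Im \<tau> > 0" and z2: "z\<^sub>2 \<notin> lattice \<tau>" and \<alpha>: "0 < \<alpha>" "\<alpha> < 1"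
  shows "flat_cone_metric \<alpha> \<tau> z\<^sub>2 (flat_density \<alpha> \<tau> z\<^sub>2)"
  unfolding flat_cone_metric_def
proof (intro conjI allI impI ballI)
  fix z l assume "l \<in> lattice \<tau>"
  then show "flat_density \<alpha> \<tau> z\<^sub>2 (z + l) = flat_density \<alpha> \<tau> z\<^sub>2 z"
    by (rule flat_density_periodic[OF \<tau>])
next
  fix z assume "z \<notin> cone_points \<tau> z\<^sub>2"
  then obtain r G where G: "r > 0" "G holomorphic_on ball z r" "\<And>y. y \<in> ball z r \<Longrightarrow> G y \<noteq> 0"
    "\<And>y. y \<in> ball z r \<Longrightarrow> flat_density \<alpha> \<tau> z\<^sub>2 y = cmod (G y)"
    using flat_density_regular[OF \<tau>] by blast
  obtain f where "developing_map (flat_density \<alpha> \<tau> z\<^sub>2) (ball z r) f"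
    using developing_map_exists[OF open_ball convex_ball G(2-4)] by blast
  then show "\<exists>U f. z \<in> U \<and> developing_map (flat_density \<alpha> \<tau> z\<^sub>2) U f"
    using G(1) centre_in_ball by blast
next
  note h2 = holomorphic_theta_shift[OF \<tau>, of z\<^sub>2]
  show "has_cone_angle (flat_density \<alpha> \<tau> z\<^sub>2) p (2 * pi * (1 + \<alpha>))" if p: "p \<in> lattice \<tau>" for p
  proof -
    obtain v where v: "v holomorphic_on UNIV" "v p \<noteq> 0" "\<And>z. theta \<tau> z = (z - p) * v z"
      using theta_factor[OF \<tau> p] by blast
    \<comment> \<open>As \<open>z\<^sub>2\<close> is off the lattice, the two families of cone
      points are disjoint, and only one theta factor vanishes at p.\<close>
    have "p - z\<^sub>2 \<notin> lattice \<tau>"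
      using z2 lattice_add[OF p lattice_uminus, of "p - z\<^sub>2"] by auto
    then show ?thesis
      using \<alpha> v(2) by (intro cone_angle_of_factor[OF _ v(1) _ h2, where c = "flat_rate \<alpha> \<tau> z\<^sub>2" and \<beta> = "-\<alpha>"])
        (auto simp: flat_density_def theta_eq_0_iff[OF \<tau>] v(3)[symmetric])
  qed
  show "has_cone_angle (flat_density \<alpha> \<tau> z\<^sub>2) p (2 * pi * (1 - \<alpha>))" if "p \<in> (+) z\<^sub>2 ` lattice \<tau>" for p
  proof -
    obtain l where l: "l \<in> lattice \<tau>" "p = z\<^sub>2 + l" using \<open>p \<in> _\<close> by blast
    obtain v where v: "v holomorphic_on UNIV" "v l \<noteq> 0" "\<And>z. theta \<tau> z = (z - l) * v z"
      using theta_factor[OF \<tau> l(1)] by blast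
    note v' = holomorphic_shift[OF v(1), of z\<^sub>2 UNIV]
    have t: "theta \<tau> (z - z\<^sub>2) = (z - p) * v (z - z\<^sub>2)" for z
      using v(3)[of "z - z\<^sub>2"] by (simp add: l(2) algebra_simps)
    have "p \<notin> lattice \<tau>"
      using z2 lattice_add[OF _ lattice_uminus[OF l(1)], of p] l(2) by auto
    moreover have "flat_density \<alpha> \<tau> z\<^sub>2 z = cmod (exp (flat_rate \<alpha> \<tau> z\<^sub>2 * z)) *
        cmod ((z - p) * v (z - z\<^sub>2)) powr (- \<alpha>) * cmod (theta \<tau> z) powr \<alpha>" for z
      unfolding flat_density_def t by (simp only: mult_ac)
    ultimately have "has_cone_angle (flat_density \<alpha> \<tau> z\<^sub>2) p (2 * pi * (1 + - \<alpha>))"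
      using \<alpha> v(2) l(2)
      by (intro cone_angle_of_factor[OF _ v' _ holomorphic_theta[OF \<tau>], where c = "flat_rate \<alpha> \<tau> z\<^sub>2" and \<beta> = \<alpha>])
        (simp_all add: theta_eq_0_iff[OF \<tau>])
    then show ?thesis by simp
  qed
qed

section \<open>Uniqueness of the flat metric up to scale\<close>

text \<open>The value 0 at regular points lets all three kinds of points share one local
  form.\<close>

definition cone_exponent :: "real \<Rightarrow> complex \<Rightarrow> complex \<Rightarrow> complex \<Rightarrow> real" where
  "cone_exponent \<alpha> \<tau> z\<^sub>2 p =
     (if p \<in> lattice \<tau> then \<alpha> else if p \<in> (+) z\<^sub>2 ` lattice \<tau> then -\<alpha> else 0)"

text \<open>The centre is excluded from the first formula because \<phi> is arbitrary at cone points
  and \<open>0 powr 0 = 0\<close>; the value at a regular centre is therefore stated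
  separately.\<close>

lemma flat_cone_metric_local_form:
  assumes "flat_cone_metric \<alpha> \<tau> z\<^sub>2 \<phi>"
  obtains r H where "r > 0" "H holomorphic_on ball p r" "\<And>z. z \<in> ball p r \<Longrightarrow> H z \<noteq> 0"
    "\<And>z. z \<in> ball p r - {p} \<Longrightarrow> \<phi> z = cmod (z - p) powr
cone_exponent \<alpha> \<tau> z\<^sub>2 p * cmod (H z)"
    "p \<notin> cone_points \<tau> z\<^sub>2 \<Longrightarrow> \<phi> p = cmod (H p)"
proof -
  consider "p \<in> lattice \<tau>" | "p \<notin> lattice \<tau>" "p \<in> (+) z\<^sub>2 ` lattice \<tau>" | "p \<notin> cone_points \<tau> z\<^sub>2"
    by (auto simp: cone_points_def)
  then show thesis
  proof cases
    case 1
    then have "has_cone_angle \<phi> p (2 * pi * (1 + \<alpha>))" using assms by (auto simp: flat_cone_metric_def)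
    then obtain r H where "r > 0" "H holomorphic_on ball p r" "\<And>z. z \<in> ball p r \<Longrightarrow> H z \<noteq> 0"
      "\<And>z. z \<in> ball p r - {p} \<Longrightarrow> \<phi> z = cmod (z - p) powr \<alpha> * cmod (H z)"
      using cone_angle_local_form by blast
    with 1 show ?thesis by (intro that[of r H]) (auto simp: cone_points_def cone_exponent_def)
  next
    case 2
    then have "has_cone_angle \<phi> p (2 * pi * (1 + - \<alpha>))" using assms by (auto simp: flat_cone_metric_def)
    then obtain r H where "r > 0" "H holomorphic_on ball p r" "\<And>z. z \<in> ball p r \<Longrightarrow> H z \<noteq> 0"
      "\<And>z. z \<in> ball p r - {p} \<Longrightarrow> \<phi> z = cmod (z - p) powr (- \<alpha>) * cmod (H z)"
      using cone_angle_local_form[of \<phi> p "- \<alpha>"] by blast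
    with 2 show ?thesis by (intro that[of r H]) (auto simp: cone_points_def cone_exponent_def)
  next
    case 3
    then obtain U f where U: "p \<in> U" "developing_map \<phi> U f" using assms by (auto simp: flat_cone_metric_def)
    then obtain r where r: "r > 0" "ball p r \<subseteq> U" by (meson developing_map_def open_contains_ball)
    have "deriv f holomorphic_on ball p r"
      using U r by (intro holomorphic_on_subset[OF holomorphic_deriv[of f U]]) (auto simp: developing_map_def)
    moreover have "deriv f z \<noteq> 0" "\<phi> z = cmod (deriv f z)" if "z \<in> ball p r" for z
      using U(2) r that unfolding developing_map_def by blast+
    ultimately show ?thesis using 3 r(1) by (intro that[of r "deriv f"]) (auto simp: cone_points_def cone_exponent_def)
  qed
qed

lemma fundamental_domain:
  assumes "Im \<tau> > 0"
  obtains l x y where "l \<in> lattice \<tau>" "x \<in> {0..1}" "y \<in> {0..1}" "z + l = of_real x + of_real y * \<tau>"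
proof -
  define b where "b = Im z / Im \<tau>"
  define a where "a = Re z - b * Re \<tau>"
  have z: "z = of_real a + of_real b * \<tau>"
    using assms by (simp add: complex_eq_iff a_def b_def)
  have "of_int (- \<lfloor>a\<rfloor>) + of_int (- \<lfloor>b\<rfloor>) * \<tau> \<in> lattice \<tau>" unfolding lattice_def by blast
  moreover have "z + (of_int (- \<lfloor>a\<rfloor>) + of_int (- \<lfloor>b\<rfloor>) * \<tau>) = of_real (frac a) + of_real (frac b) * \<tau>"
    by (simp add: z frac_def algebra_simps)
  ultimately show thesis
    by (intro that[of _ "frac a" "frac b"]) (auto simp: frac_lt_1 less_imp_le)
qed

text \<open>Zeros of theta are isolated by \<open>theta_factor\<close>. Periodicity of a metric is
  given only off the cone points; with this it passes to limits at them.\<close>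

lemma eventually_not_cone_point:
  assumes \<tau>: "Im \<tau> > 0"
  shows "\<forall>\<^sub>F y in at z. y \<notin> cone_points \<tau> z\<^sub>2"
proof -
  have *: "\<exists>r>0. \<forall>y\<in>ball p r - {p}. theta \<tau> y \<noteq> 0" for p
  proof (cases "theta \<tau> p = 0")
    case True
    then obtain v where v: "v holomorphic_on UNIV" "v p \<noteq> 0" "\<And>z. theta \<tau> z = (z - p) * v z"
      using theta_factor[OF \<tau>, of p] theta_eq_0_iff[OF \<tau>] by blast
    obtain r where "r > 0" "\<And>z. z \<in> ball p r \<Longrightarrow> v z \<noteq> 0"
      using holomorphic_nonzero_ball[OF v(1,2)] by blast
    then show ?thesis unfolding v(3) by (intro exI[of _ r]) auto
  next
    case False
    obtain r where "r > 0" "\<And>z. z \<in> ball p r \<Longrightarrow> theta \<tau> z \<noteq> 0"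
      by (rule holomorphic_nonzero_ball[OF holomorphic_theta[OF \<tau>] False]) simp
    then show ?thesis by (intro exI[of _ r]) auto
  qed
  obtain r s where r: "r > 0" "\<And>y. y \<in> ball z r - {z} \<Longrightarrow> theta \<tau> y \<noteq> 0"
    and s: "s > 0" "\<And>y. y \<in> ball (z - z\<^sub>2) s - {z - z\<^sub>2} \<Longrightarrow> theta \<tau> y \<noteq> 0"
    using *[of z] *[of "z - z\<^sub>2"] by metis
  have "\<forall>y. y \<noteq> z \<and> dist y z < min r s \<longrightarrow> y \<notin> cone_points \<tau> z\<^sub>2"
  proof (intro allI impI)
    fix y assume "y \<noteq> z \<and> dist y z < min r s"
    then have "y \<in> ball z r - {z}" "y - z\<^sub>2 \<in> ball (z - z\<^sub>2) s - {z - z\<^sub>2}"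
      by (auto simp: dist_norm norm_minus_commute)
    then show "y \<notin> cone_points \<tau> z\<^sub>2" using r(2) s(2) by (simp add: cone_points_iff[OF \<tau>])
  qed
  moreover have "min r s > 0" using r(1) s(1) by simp
  ultimately show ?thesis unfolding eventually_at by blast
qed

text \<open>The ratio of two such metrics is, up to removable singularities, locally the modulus of a
  nonvanishing holomorphic function, and it attains its maximum because it is periodic.\<close>

lemma flat_cone_metric_unique:
  assumes \<tau>: "Im \<tau> > 0" and \<phi>: "flat_cone_metric \<alpha> \<tau> z\<^sub>2 \<phi>" and \<psi>: "flat_cone_metric \<alpha> \<tau> z\<^sub>2 \<psi>"
  obtains M where "M > 0" "\<And>z. z \<notin> cone_points \<tau> z\<^sub>2 \<Longrightarrow> \<phi> z = M * \<psi> z"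
proof -
  define R where "R z = \<phi> z / \<psi> z" for z
  \<comment> \<open>\<rho> replaces the meaningless values of R at the cone points by
    limits.\<close>
  define \<rho> where "\<rho> p = Lim (at p) R" for p
  have loc: "\<exists>r F. r > 0 \<and> F holomorphic_on ball p r \<and> (\<forall>z\<in>ball p r. F z \<noteq> 0 \<and> \<rho> z = cmod (F z)) \<and>
      (p \<notin> cone_points \<tau> z\<^sub>2 \<longrightarrow> R p = \<rho> p) \<and> (R \<longlongrightarrow> \<rho> p) (at p)" for p
  proof -
    \<comment> \<open>Both metrics have the same exponent at p, so the powers cancel in R.\<close>
    define e where "e = cone_exponent \<alpha> \<tau> z\<^sub>2 p"
    obtain r1 H1 where 1: "r1 > 0" "H1 holomorphic_on ball p r1" "\<And>z. z \<in> ball p r1 \<Longrightarrow> H1 z \<noteq> 0"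
      "\<And>z. z \<in> ball p r1 - {p} \<Longrightarrow> \<phi> z = cmod (z - p) powr e * cmod (H1 z)"
      "p \<notin> cone_points \<tau> z\<^sub>2 \<Longrightarrow> \<phi> p = cmod (H1 p)"
      using flat_cone_metric_local_form[OF \<phi>, of p] unfolding e_def by blast
    obtain r2 H2 where 2: "r2 > 0" "H2 holomorphic_on ball p r2" "\<And>z. z \<in> ball p r2 \<Longrightarrow> H2 z \<noteq> 0"
      "\<And>z. z \<in> ball p r2 - {p} \<Longrightarrow> \<psi> z = cmod (z - p) powr e * cmod (H2 z)"
      "p \<notin> cone_points \<tau> z\<^sub>2 \<Longrightarrow> \<psi> p = cmod (H2 p)"
      using flat_cone_metric_local_form[OF \<psi>, of p] unfolding e_def by blast
    define r where "r = min r1 r2"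
    define F where "F z = H1 z / H2 z" for z
    have r: "r > 0" "ball p r \<subseteq> ball p r1" "ball p r \<subseteq> ball p r2" using 1 2 by (auto simp: r_def)
    have F: "F holomorphic_on ball p r"
      unfolding F_def using 1(2) 2(2,3) r by (intro holomorphic_on_divide) (auto intro: holomorphic_on_subset)
    have FR: "R z = cmod (F z)" if "z \<in> ball p r - {p}" for z
    proof -
      have z: "z \<in> ball p r1 - {p}" "z \<in> ball p r2 - {p}" using that r by auto
      then have "cmod (z - p) powr e \<noteq> 0" by simp
      then show ?thesis unfolding R_def F_def 1(4)[OF z(1)] 2(4)[OF z(2)] by (simp add: norm_divide)
    qed
    have lim: "(R \<longlongrightarrow> cmod (F z)) (at z)" if z: "z \<in> ball p r" for z
    proof -
      have "continuous_on (ball p r) F" using F by (rule holomorphic_on_imp_continuous_on)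
      then have "isCont F z" using z continuous_on_eq_continuous_at[OF open_ball] by blast
      then have *: "((\<lambda>z. cmod (F z)) \<longlongrightarrow> cmod (F z)) (at z)" by (intro tendsto_norm) (simp add: isCont_def)
      have "eventually (\<lambda>y. y \<in> ball p r) (at z)" using z by (intro eventually_at_in_open') auto
      moreover have "eventually (\<lambda>y. y \<noteq> p) (at z)"
        by (rule eventually_neq_at_within)
      ultimately have "eventually (\<lambda>y. cmod (F y) = R y) (at z)"
      proof eventually_elim
        case (elim y)
        then show ?case using FR[of y] by simp
      qed
      with * show ?thesis by (rule Lim_transform_eventually)
    qed
    have \<rho>: "\<rho> z = cmod (F z)" if "z \<in> ball p r" for z
      unfolding \<rho>_def using lim[OF that] by (intro tendsto_Lim) auto
    have "R p = \<rho> p" if "p \<notin> cone_points \<tau> z\<^sub>2"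
      using 1(5) 2(5) that \<rho>[of p] r(1) by (simp add: R_def F_def norm_divide)
    moreover have "(R \<longlongrightarrow> \<rho> p) (at p)" using lim[of p] \<rho>[of p] r(1) by simp
    moreover have "F z \<noteq> 0" if "z \<in> ball p r" for z
      using 1(3) 2(3) r that unfolding F_def by auto
    ultimately show ?thesis using r(1) F \<rho> by (intro exI[of _ r] exI[of _ F]) auto
  qed
  have cont: "continuous_on UNIV \<rho>"
  proof (rule continuous_at_imp_continuous_on, intro ballI)
    fix p
    obtain r F where F: "r > 0" "F holomorphic_on ball p r" "\<And>z. z \<in> ball p r \<Longrightarrow> \<rho> z = cmod (F z)"
      using loc[of p] by blast
    have "continuous_on (ball p r) (\<lambda>z. cmod (F z))"
      using F(2) by (intro continuous_intros holomorphic_on_imp_continuous_on)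
    then have "continuous_on (ball p r) \<rho>" by (rule continuous_on_eq) (simp add: F(3))
    then show "isCont \<rho> p" using F(1) by (simp add: continuous_on_eq_continuous_at)
  qed
  have per: "\<rho> (z + l) = \<rho> z" if l: "l \<in> lattice \<tau>" for z l
  proof -
    have "eventually (\<lambda>y. y \<notin> cone_points \<tau> z\<^sub>2) (at z)" by (rule eventually_not_cone_point[OF \<tau>])
    then have "eventually (\<lambda>y. R y = R (y + l)) (at z)"
    proof eventually_elim
      case (elim y)
      then show ?case using \<phi> \<psi> l unfolding R_def flat_cone_metric_def by simp
    qed
    moreover have "((\<lambda>y. R (y + l)) \<longlongrightarrow> \<rho> (z + l)) (at z)"
      using loc[of "z + l"] LIM_offset[of R "\<rho> (z + l)" "z + l" l] by auto
    ultimately have "(R \<longlongrightarrow> \<rho> (z + l)) (at z)"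
      using tendsto_cong[of R "\<lambda>y. R (y + l)"] by blast
    moreover have "(R \<longlongrightarrow> \<rho> z) (at z)" using loc[of z] by blast
    ultimately show ?thesis using tendsto_unique[OF at_neq_bot] by blast
  qed
  define K where "K = (\<lambda>(x, y). complex_of_real x + complex_of_real y * \<tau>) ` ({0..1} \<times> {0..1})"
  have "compact K" unfolding K_def
    by (intro compact_continuous_image compact_Times compact_Icc)
      (auto simp: case_prod_beta intro!: continuous_intros)
  moreover have "K \<noteq> {}" by (auto simp: K_def)
  ultimately obtain p where p: "p \<in> K" "\<And>z. z \<in> K \<Longrightarrow> \<rho> z \<le> \<rho> p"
    using continuous_attains_sup[of K \<rho>] continuous_on_subset[OF cont] by blast
  have max: "\<rho> z \<le> \<rho> p" for z
  proof -
    obtain l x y where "l \<in> lattice \<tau>" "x \<in> {0..1}" "y \<in> {0..1}" "z + l = of_real x + of_real y * \<tau>"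
      using fundamental_domain[OF \<tau>] by blast
    then show ?thesis using p(2)[of "z + l"] per[of l z] by (force simp: K_def)
  qed
  \<comment> \<open>Near a point where \<rho> is maximal, the maximum modulus principle makes F
    constant; so the set of these points is open as well as closed.\<close>
  define A where "A = {z. \<rho> z = \<rho> p}"
  have "closed A"
    using continuous_closed_preimage_constant[OF cont closed_UNIV, of "\<rho> p"] by (simp add: A_def)
  moreover have "open A"
  proof (subst open_contains_ball, intro ballI)
    fix a assume a: "a \<in> A"
    obtain r F where F: "r > 0" "F holomorphic_on ball a r" "\<And>z. z \<in> ball a r \<Longrightarrow> \<rho> z = cmod (F z)"
      using loc[of a] by blast
    have "F constant_on ball a r"
      by (rule maximum_modulus_principle[OF F(2), of "ball a r" a])
        (use F(1) F(3)[symmetric] a max in \<open>auto simp: A_def\<close>)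
    then obtain c where "\<And>z. z \<in> ball a r \<Longrightarrow> F z = c" by (auto simp: constant_on_def)
    then have "ball a r \<subseteq> A" using F(1,3) a F(3)[of a] by (auto simp: A_def)
    then show "\<exists>e>0. ball a e \<subseteq> A" using F(1) by blast
  qed
  moreover have "p \<in> A" by (simp add: A_def)
  ultimately have "A = UNIV" using clopen[of A] by blast
  then have const: "\<rho> z = \<rho> p" for z by (auto simp: A_def)
  have pos: "\<rho> p > 0"
  proof -
    obtain r F where "r > 0" "\<And>z. z \<in> ball p r \<Longrightarrow> F z \<noteq> 0 \<and> \<rho> z = cmod (F z)" using loc[of p] by blast
    then show ?thesis by (metis centre_in_ball zero_less_norm_iff)
  qed
  show thesis
  proof (rule that[OF pos])
    fix z assume z: "z \<notin> cone_points \<tau> z\<^sub>2"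
    then have R: "R z = \<rho> p" using loc[of z] const by metis
    then have "\<psi> z \<noteq> 0" using pos by (auto simp: R_def)
    then show "\<phi> z = \<rho> p * \<psi> z" using R by (simp add: R_def field_simps)
  qed
qed

section \<open>Linear holonomy\<close>

text \<open>The values of D are integer multiples of 2 pi i, and distinct ones are at least 1
  apart.\<close>

lemma exp_eq_1_imp_constant:
  fixes D :: "complex \<Rightarrow> complex"
  assumes "connected S" "continuous_on S D" "\<And>z. z \<in> S \<Longrightarrow> exp (D z) = 1" "x \<in> S" "y \<in> S"
  shows "D x = D y"
proof -
  have "D constant_on S"
  proof (rule continuous_discrete_range_constant[OF assms(1,2)])
    fix x assume x: "x \<in> S"
    have "1 \<le> norm (D y - D x)" if y: "y \<in> S" "D y \<noteq> D x" for y
    proof -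
      obtain n :: int where n: "Re (D y) = 0" "Im (D y) = of_int (2 * n) * pi"
        using assms(3)[OF y(1)] unfolding exp_eq_1 by blast
      obtain m :: int where m: "Re (D x) = 0" "Im (D x) = of_int (2 * m) * pi"
        using assms(3)[OF x] unfolding exp_eq_1 by blast
      have "n \<noteq> m" using y(2) n m by (auto simp: complex_eq_iff)
      define k where "k = n - m"
      have "1 \<le> 2 * \<bar>k\<bar>" using \<open>n \<noteq> m\<close> unfolding k_def by presburger
      then have "(1::real) \<le> real_of_int (2 * \<bar>k\<bar>)" by (simp only: of_int_1_le_iff)
      then have "1 * 1 \<le> real_of_int (2 * \<bar>k\<bar>) * pi"
        by (rule mult_mono) (use pi_ge_two in auto)
      also have "\<dots> = \<bar>of_int (2 * k) * pi\<bar>" by (simp add: abs_mult)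
      also have "of_int (2 * k) * pi = Im (D y - D x)" by (simp add: k_def n m algebra_simps)
      also have "\<bar>Im (D y - D x)\<bar> \<le> norm (D y - D x)" by (rule abs_Im_le_cmod)
      finally show ?thesis by simp
    qed
    then show "\<exists>e>0. \<forall>y. y \<in> S \<and> D y \<noteq> D x \<longrightarrow> e \<le> norm (D y - D x)"
      by (intro exI[of _ 1]) auto
  qed
  then show ?thesis using assms(4,5) by (auto simp: constant_on_def)
qed

text \<open>The functional \<open>f\<close> is the lattice coordinate along \<open>\<omega>'\<close>, for a lattice basis \<open>\<omega>, \<omega>'\<close>.  On the strip
  \<open>-1 < f < 0\<close> theta has a logarithm \<open>L\<close>; translating by \<open>n \<omega>'\<close> brings the shifted path back to this strip.
  The unknown multiple of \<open>2\<pi>\<i>\<close> in \<open>L (z + \<omega>) - L z\<close> cancels between the two theta factors.\<close>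

lemma flat_holonomy_loop:
  fixes f :: "complex \<Rightarrow> real"
  assumes \<tau>: "Im \<tau> > 0" and M: "M > 0"
    and \<phi>: "\<And>z. z \<notin> cone_points \<tau> z\<^sub>2 \<Longrightarrow> \<phi> z = M * flat_density \<alpha> \<tau> z\<^sub>2 z"
    and f: "bounded_linear f" "f \<omega> = 0" "\<And>l. l \<in> lattice \<tau> \<Longrightarrow> f l \<in> \<int>"
    and \<omega>: "\<And>z. theta \<tau> (z + \<omega>) = exp (s + r * z) * theta \<tau> z"
    and \<omega>': "\<And>z. theta \<tau> (z + of_int n * \<omega>') = exp (s' + of_int n * r' * z) * theta \<tau> z"
    and p: "-1 < f p" "f p < 0" "-1 < f (p - z\<^sub>2 - of_int n * \<omega>')" "f (p - z\<^sub>2 - of_int n * \<omega>') < 0"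
  shows "has_linear_holonomy \<phi> (\<lambda>t. p + of_real t * \<omega>)
    (exp (flat_rate \<alpha> \<tau> z\<^sub>2 * \<omega> + of_real \<alpha> * (r * (z\<^sub>2 + of_int n * \<omega>') - of_int n * r' * \<omega>)))"
proof -
  interpret f: bounded_linear f by (rule f(1))
  define S where "S = {z. -1 < f z \<and> f z < 0}"
  define a where "a = z\<^sub>2 + of_int n * \<omega>'"
  have S: "open S" "convex S"
  proof -
    have eq: "S = f -` {-1<..<0}" by (auto simp: S_def)
    show "open S" unfolding eq by (intro open_vimage f.continuous_on continuous_on_id open_greaterThanLessThan)
    show "convex S" unfolding eq by (intro convex_linear_vimage f.linear convex_real_interval)
  qed
  \<comment> \<open>Since f \<omega> = 0, the strip is invariant in the direction of the
    loop.\<close>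
  have S\<omega>: "z + of_real t * \<omega> \<in> S \<longleftrightarrow> z \<in> S" for z t
    using f.scaleR[of t \<omega>] f(2) by (simp add: S_def f.add scaleR_conv_of_real)
  \<comment> \<open>f is an integer at every zero of theta, and the open strip lies between two
    integers.\<close>
  have nz: "theta \<tau> z \<noteq> 0" if "z \<in> S" for z
  proof
    assume "theta \<tau> z = 0"
    then have "f z \<in> \<int>" using theta_eq_0_iff[OF \<tau>] f(3) by blast
    then obtain k :: int where "f z = of_int k" by (auto elim: Ints_cases)
    then show False using that unfolding S_def by simp linarith
  qed
  have pS: "p \<in> S" "p - a \<in> S" using p by (auto simp: S_def a_def algebra_simps)
  obtain L where L: "L holomorphic_on S" "\<And>z. z \<in> S \<Longrightarrow> exp (L z) = theta \<tau> z"
    using holomorphic_logarithm_exists[OF S(2,1) holomorphic_theta[OF \<tau>] nz pS(1)] by blast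
  define D where "D z = L (z + of_real 1 * \<omega>) - L z - (s + r * z)" for z
  have "continuous_on S D"
  proof -
    have "continuous_on S L" using L(1) by (rule holomorphic_on_imp_continuous_on)
    moreover have "continuous_on S (\<lambda>z. L (z + of_real 1 * \<omega>))"
      by (rule continuous_on_compose2[OF calculation]) (use S\<omega>[of _ 1] in \<open>auto intro!: continuous_intros\<close>)
    ultimately show ?thesis unfolding D_def by (intro continuous_intros)
  qed
  moreover have "exp (D z) = 1" if z: "z \<in> S" for z
  proof -
    have "exp (D z) = exp (L (z + of_real 1 * \<omega>)) / exp (L z) / exp (s + r * z)"
      by (simp add: D_def exp_diff)
    also have "\<dots> = 1" using z S\<omega>[of z 1] nz[OF z] by (simp add: L(2) \<omega>)
    finally show ?thesis .
  qed
  ultimately have "D p = D (p - a)"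
    using exp_eq_1_imp_constant[OF convex_connected[OF S(2)]] pS by blast
  then have D: "L (p + \<omega>) - L p - (L (p - a + \<omega>) - L (p - a)) = r * a"
    by (simp add: D_def algebra_simps)
  \<comment> \<open>z in S serves theta(z); z - a in S serves theta(z - z2), because z - z2 = (z -
    a) + n \<omega>'. On U both factors thus have logarithms, from which G is formed.\<close>
  define U where "U = S \<inter> (\<lambda>z. z - a) -` S"
  define G where "G z = of_real M * exp (flat_rate \<alpha> \<tau> z\<^sub>2 * z + of_real \<alpha> * L z
      - of_real \<alpha> * (s' + of_int n * r' * (z - a) + L (z - a)))" for z
  have "has_linear_holonomy \<phi> (\<lambda>t. p + of_real t * \<omega>) (G (p + of_real 1 * \<omega>) / G (p + of_real 0 * \<omega>))"
  proof (rule linear_holonomy_exists[of U])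
    have "(\<lambda>z. z - a) -` S = (\<lambda>z. z + a) ` S" by (auto simp: image_iff) (metis diff_add_cancel)
    then show "convex U" unfolding U_def
      using S(2) convex_translation[of S a] by (auto intro!: convex_Int simp: add.commute)
    show "open U" unfolding U_def
      using S(1) by (intro open_Int open_vimage continuous_intros)
    have "(\<lambda>z. L (z - a)) holomorphic_on U"
    proof -
      have "(\<lambda>z. z - a) holomorphic_on U" by (intro holomorphic_intros)
      moreover have "(\<lambda>z. z - a) ` U \<subseteq> S" by (auto simp: U_def)
      ultimately show ?thesis
        using holomorphic_on_compose_gen[OF _ L(1)] by (fastforce simp: o_def)
    qed
    moreover have "L holomorphic_on U" using L(1) by (rule holomorphic_on_subset) (auto simp: U_def)
    ultimately show "G holomorphic_on U" unfolding G_def by (intro holomorphic_intros)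
    show "G z \<noteq> 0" for z using M by (simp add: G_def)
    show "(\<lambda>t. p + of_real t * \<omega>) ` {0..1} \<subseteq> U"
    proof -
      have "p + of_real t * \<omega> - a = p - a + of_real t * \<omega>" for t by simp
      then have "p + of_real t * \<omega> - a \<in> S" for t using S\<omega> pS(2) by metis
      then show ?thesis using pS(1) by (auto simp: U_def S\<omega>)
    qed
    fix z assume "z \<in> U"
    then have z: "z \<in> S" "z - a \<in> S" by (auto simp: U_def)
    have t1: "theta \<tau> z = exp (L z)" using L(2) z by simp
    have t2: "theta \<tau> (z - z\<^sub>2) = exp (s' + of_int n * r' * (z - a) + L (z - a))"
    proof -
      have "theta \<tau> (z - z\<^sub>2) = theta \<tau> ((z - a) + of_int n * \<omega>')" by (simp add: a_def)
      also have "\<dots> = exp (s' + of_int n * r' * (z - a)) * exp (L (z - a))"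
        unfolding \<omega>' L(2)[OF z(2)] ..
      finally show ?thesis by (simp only: exp_add)
    qed
    have "z \<notin> cone_points \<tau> z\<^sub>2" by (simp add: cone_points_iff[OF \<tau>] t1 t2)
    then have "\<phi> z = M * flat_density \<alpha> \<tau> z\<^sub>2 z" by (rule \<phi>)
    also have "\<dots> = cmod (G z)"
      using M unfolding flat_density_def t1 t2 G_def
      by (simp add: norm_mult exp_powr_real exp_add[symmetric] exp_diff[symmetric] algebra_simps del: exp_add exp_diff)
    finally show "\<phi> z = cmod (G z)" .
  qed
  also have "G (p + of_real 1 * \<omega>) / G (p + of_real 0 * \<omega>)
    = exp (flat_rate \<alpha> \<tau> z\<^sub>2 * \<omega> + of_real \<alpha> * (L (p + \<omega>) - L p - (L (p - a + \<omega>) - L (p - a)) - of_int n * r' * \<omega>))"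
    using M by (simp add: G_def exp_diff[symmetric] algebra_simps del: exp_diff)
  finally show ?thesis unfolding D unfolding a_def .
qed

text \<open>\<open>flat_holonomy_loop\<close> is applied with (\<omega>, \<omega>') equal to (1,
  \<tau>) and to (\<tau>, 1). Floor and ceiling select the translate that brings the shifted loop
  into the strip; one of each occurs because \<open>z\<^sub>2\<close> has lattice coordinates a and
  -b.\<close>

lemma holonomy_map_eq:
  fixes a b \<alpha>\<^sub>1 :: real
  assumes \<alpha>: "0 < \<alpha>\<^sub>1" "\<alpha>\<^sub>1 < 1" and \<tau>: "Im \<tau> > 0" and z2: "z\<^sub>2 \<notin> lattice \<tau>" "z\<^sub>2 = of_real a * \<tau> - of_real b"
  shows "holonomy_map \<alpha>\<^sub>1 (\<tau>, z\<^sub>2) =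
    (cis (2 * pi * \<alpha>\<^sub>1 * (a - of_int \<lfloor>a\<rfloor>)), cis (2 * pi * \<alpha>\<^sub>1 * (b - of_int \<lceil>b\<rceil>)))" (is "_ = (?x, ?y)")
proof -
  let ?\<phi> = "troyanov_metric \<alpha>\<^sub>1 \<tau> z\<^sub>2"
  note flat = flat_cone_metric_flat_density[OF \<tau> z2(1) \<alpha>]
  have "flat_cone_metric \<alpha>\<^sub>1 \<tau> z\<^sub>2 ?\<phi>" unfolding troyanov_metric_def using flat by (rule someI[of "flat_cone_metric \<alpha>\<^sub>1 \<tau> z\<^sub>2"])
  from flat_cone_metric_unique[OF \<tau> this flat]
  obtain M where M: "M > 0" "\<And>z. z \<notin> cone_points \<tau> z\<^sub>2 \<Longrightarrow> ?\<phi> z = M * flat_density \<alpha>\<^sub>1 \<tau> z\<^sub>2 z" by blast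
  have Im: "Im z\<^sub>2 / Im \<tau> = a" using \<tau> by (simp add: z2(2))
  \<comment> \<open>f and g are the lattice coordinates along \<tau> and along 1.\<close>
  define f where "f z = Im z / Im \<tau>" for z
  define g where "g z = Re z - Im z / Im \<tau> * Re \<tau>" for z
  have f: "bounded_linear f" "bounded_linear g"
    unfolding linear_conv_bounded_linear[symmetric]
    by (rule linearI; simp add: f_def g_def add_divide_distrib algebra_simps)+
  have fs: "f (of_real x + of_real y * \<tau>) = y" "g (of_real x + of_real y * \<tau>) = x" for x y
    using \<tau> by (simp_all add: f_def g_def)
  have fl: "f l \<in> \<int>" "g l \<in> \<int>" if l: "l \<in> lattice \<tau>" for l
  proof -
    obtain m n where "l = of_real (of_int m) + of_real (of_int n) * \<tau>" using l by (auto simp: lattice_def)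
    then show "f l \<in> \<int>" "g l \<in> \<int>" by (simp_all only: fs) simp_all
  qed
  \<comment> \<open>The coordinates that must lie in (-1, 0) are -\<epsilon>, -\<epsilon> - (a -
    floor a) and -\<epsilon> + (b - ceiling b).\<close>
  define e where "e = min 1 (min (1 - (a - of_int \<lfloor>a\<rfloor>)) (1 + (b - of_int \<lceil>b\<rceil>)))"
  have e: "e > 0" unfolding e_def by linarith
  have hol: "has_linear_holonomy ?\<phi> (\<lambda>t. base_point \<tau> \<epsilon> + of_real t) ?x \<and>
      has_linear_holonomy ?\<phi> (\<lambda>t. base_point \<tau> \<epsilon> + of_real t * \<tau>) ?y" if \<epsilon>: "0 < \<epsilon>" "\<epsilon> < e" for \<epsilon>
  proof
    have bp: "base_point \<tau> \<epsilon> = of_real (- \<epsilon>) + of_real (- \<epsilon>) * \<tau>"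
      by (simp add: base_point_def algebra_simps)
    define n where "n = - \<lfloor>a\<rfloor>"
    obtain s' where s': "\<And>z. theta \<tau> (z + of_int n * \<tau>) = exp (s' + of_int n * (- (2 * of_real pi * \<i>)) * z) * theta \<tau> z"
      using theta_plus_n_tau[OF \<tau>, of n] by (auto simp: mult_ac)
    have sh: "base_point \<tau> \<epsilon> - z\<^sub>2 - of_int n * \<tau> = of_real (b - \<epsilon>) + of_real (- \<epsilon> - a - of_int n) * \<tau>"
      by (simp add: bp z2(2) algebra_simps)
    have "has_linear_holonomy ?\<phi> (\<lambda>t. base_point \<tau> \<epsilon> + of_real t * 1)
      (exp (flat_rate \<alpha>\<^sub>1 \<tau> z\<^sub>2 * 1 + of_real \<alpha>\<^sub>1 * (0 * (z\<^sub>2 + of_int n * \<tau>) - of_int n * (- (2 * of_real pi * \<i>)) * 1)))"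
    proof (rule flat_holonomy_loop[OF \<tau> M f(1) _ fl(1) _ s'])
      show "f 1 = 0" by (simp add: f_def)
      show "theta \<tau> (z + 1) = exp (0 + 0 * z) * theta \<tau> z" for z by (simp add: theta_plus_1)
      show "-1 < f (base_point \<tau> \<epsilon>)" "f (base_point \<tau> \<epsilon>) < 0" using \<epsilon> unfolding bp fs e_def by auto
      show "-1 < f (base_point \<tau> \<epsilon> - z\<^sub>2 - of_int n * \<tau>)" "f (base_point \<tau> \<epsilon> - z\<^sub>2 - of_int n * \<tau>) < 0"
        using \<epsilon> unfolding sh fs unfolding e_def n_def by linarith+
    qed
    also have "exp (flat_rate \<alpha>\<^sub>1 \<tau> z\<^sub>2 * 1 + of_real \<alpha>\<^sub>1 * (0 * (z\<^sub>2 + of_int n * \<tau>) - of_int n * (- (2 * of_real pi * \<i>)) * 1)) = ?x"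
      by (simp add: flat_rate_def Im n_def cis_conv_exp algebra_simps)
    finally show "has_linear_holonomy ?\<phi> (\<lambda>t. base_point \<tau> \<epsilon> + of_real t) ?x" by simp
    define m where "m = \<lceil>b\<rceil>"
    have sh: "base_point \<tau> \<epsilon> - z\<^sub>2 - of_int m * 1 = of_real (b - \<epsilon> - of_int m) + of_real (- \<epsilon> - a) * \<tau>"
      by (simp add: bp z2(2) algebra_simps)
    have "has_linear_holonomy ?\<phi> (\<lambda>t. base_point \<tau> \<epsilon> + of_real t * \<tau>)
      (exp (flat_rate \<alpha>\<^sub>1 \<tau> z\<^sub>2 * \<tau> + of_real \<alpha>\<^sub>1 * (- (2 * of_real pi * \<i>) * (z\<^sub>2 + of_int m * 1) - of_int m * 0 * \<tau>)))"
    proof (rule flat_holonomy_loop[OF \<tau> M f(2) _ fl(2)])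
      show "g \<tau> = 0" using \<tau> by (simp add: g_def)
      show "theta \<tau> (z + \<tau>) = exp (pi * \<i> + - (2 * of_real pi * \<i>) * z) * theta \<tau> z" for z
        unfolding theta_plus_tau[OF \<tau>] exp_add exp_pi_i by simp
      show "theta \<tau> (z + of_int m * 1) = exp (0 + of_int m * 0 * z) * theta \<tau> z" for z
        by (simp add: theta_plus_int)
      show "-1 < g (base_point \<tau> \<epsilon>)" "g (base_point \<tau> \<epsilon>) < 0" using \<epsilon> unfolding bp fs e_def by auto
      show "-1 < g (base_point \<tau> \<epsilon> - z\<^sub>2 - of_int m * 1)" "g (base_point \<tau> \<epsilon> - z\<^sub>2 - of_int m * 1) < 0"
        using \<epsilon> unfolding sh fs unfolding e_def m_def by linarith+
    qed
    \<comment> \<open>The two terms in a \<tau> cancel, which leaves an exponent free of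
      \<tau>.\<close>
    also have "exp (flat_rate \<alpha>\<^sub>1 \<tau> z\<^sub>2 * \<tau> + of_real \<alpha>\<^sub>1 * (- (2 * of_real pi * \<i>) * (z\<^sub>2 + of_int m * 1) - of_int m * 0 * \<tau>)) = ?y"
      by (simp add: flat_rate_def Im m_def cis_conv_exp) (simp add: z2(2) algebra_simps)
    finally show "has_linear_holonomy ?\<phi> (\<lambda>t. base_point \<tau> \<epsilon> + of_real t * \<tau>) ?y" .
  qed
  have ev: "\<forall>\<^sub>F \<epsilon> in at_right 0. has_linear_holonomy ?\<phi> (\<lambda>t. base_point \<tau> \<epsilon> + of_real t) ?x \<and>
      has_linear_holonomy ?\<phi> (\<lambda>t. base_point \<tau> \<epsilon> + of_real t * \<tau>) ?y"
    using e hol by (auto simp: eventually_at_right)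
  show ?thesis
    unfolding holonomy_map_def prod.case
  proof (rule the_equality)
    fix q assume q: "case q of (\<zeta>, \<zeta>') \<Rightarrow> \<forall>\<^sub>F \<epsilon> in at_right 0.
       has_linear_holonomy ?\<phi> (\<lambda>t. base_point \<tau> \<epsilon> + of_real t) \<zeta> \<and>
       has_linear_holonomy ?\<phi> (\<lambda>t. base_point \<tau> \<epsilon> + of_real t * \<tau>) \<zeta>'"
    obtain \<zeta> \<zeta>' where q': "q = (\<zeta>, \<zeta>')" by (cases q)
    have c1: "continuous_on {0..1} (\<lambda>t. base_point \<tau> \<epsilon> + of_real t)"
      and c2: "continuous_on {0..1} (\<lambda>t. base_point \<tau> \<epsilon> + of_real t * \<tau>)" for \<epsilon>
      by (intro continuous_intros)+
    have "\<forall>\<^sub>F \<epsilon> in at_right (0::real). \<zeta> = ?x \<and> \<zeta>' = ?y"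
      using q[unfolded q' prod.case] ev
    proof eventually_elim
      case (elim \<epsilon>)
      then show ?case
        using linear_holonomy_unique[OF c1] linear_holonomy_unique[OF c2] by blast
    qed
    \<comment> \<open>\<open>at_right 0\<close> is a nontrivial filter, so an eventual statement
      that does not mention \<epsilon> holds outright.\<close>
    then show "q = (?x, ?y)" by (simp add: q')
  qed (use ev in simp)
qed

section \<open>Real analyticity\<close>

text \<open>Unlike in \<open>real_analytic_on\<close>, the radius is fixed and no domain occurs, so
  expansions at one point can be added and multiplied by coordinates.\<close>

definition power_series_on_ball ::
    "('a::euclidean_space \<Rightarrow> 'b::euclidean_space) \<Rightarrow> 'a \<Rightarrow> real \<Rightarrow> bool" where
  "power_series_on_ball f a r \<longleftrightarrow> (\<exists>c :: ('a \<Rightarrow> nat) \<Rightarrow> 'b. \<forall>x\<in>ball a r.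
     ((\<lambda>m. (\<Prod>i\<in>Basis. ((x - a) \<bullet> i) ^ m i) *\<^sub>R c m) has_sum f x) (Basis \<rightarrow>\<^sub>E UNIV))"

lemma power_series_on_ball_add:
  assumes "power_series_on_ball f a r" "power_series_on_ball g a r"
  shows "power_series_on_ball (\<lambda>x. f x + g x) a r"
proof -
  obtain c where c: "\<And>x. x \<in> ball a r \<Longrightarrow>
      ((\<lambda>m. (\<Prod>i\<in>Basis. ((x - a) \<bullet> i) ^ m i) *\<^sub>R c m) has_sum f x) (Basis \<rightarrow>\<^sub>E UNIV)"
    using assms(1) unfolding power_series_on_ball_def by blast
  obtain d where d: "\<And>x. x \<in> ball a r \<Longrightarrow>
      ((\<lambda>m. (\<Prod>i\<in>Basis. ((x - a) \<bullet> i) ^ m i) *\<^sub>R d m) has_sum g x) (Basis \<rightarrow>\<^sub>E UNIV)"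
    using assms(2) unfolding power_series_on_ball_def by blast
  show ?thesis
    unfolding power_series_on_ball_def
    by (rule exI[of _ "\<lambda>m. c m + d m"])
      (use has_sum_add[OF c d] in \<open>simp add: scaleR_add_right\<close>)
qed

text \<open>Powers of one coordinate are the monomials whose multi-index is supported at j; all
  other coefficients are 0.\<close>

lemma power_series_on_ball_univariate:
  assumes j: "j \<in> Basis"
    and b: "\<And>t. \<bar>t\<bar> < r \<Longrightarrow> ((\<lambda>n. t ^ n *\<^sub>R b n) has_sum g t) UNIV"
  shows "power_series_on_ball (\<lambda>x. g ((x - a) \<bullet> j)) a r"
proof -
  \<comment> \<open>The restriction makes e n extensional, as membership in
    \<open>Basis \<rightarrow>\<^sub>E UNIV\<close> requires.\<close>
  define e where "e n = (\<lambda>i\<in>Basis. if i = j then n else 0)" for n :: nat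
  have inj: "inj e"
    by (rule inj_onI) (use j in \<open>auto simp: e_def fun_eq_iff restrict_def split: if_splits\<close>)
  have monom: "(\<Prod>i\<in>Basis. t i ^ e n i) = t j ^ n" for t :: "_ \<Rightarrow> real" and n
  proof -
    have "(\<Prod>i\<in>Basis. t i ^ e n i) = (\<Prod>i\<in>Basis. if i = j then t j ^ n else 1)"
      by (rule prod.cong) (auto simp: e_def)
    also have "\<dots> = t j ^ n" using j by simp
    finally show ?thesis .
  qed
  show ?thesis
    unfolding power_series_on_ball_def
  proof (intro exI[of _ "\<lambda>m. if m \<in> range e then b (m j) else 0"] ballI)
    fix x assume x: "x \<in> ball a r"
    have "\<bar>(x - a) \<bullet> j\<bar> < r"
      using Basis_le_norm[OF j, of "x - a"] x by (simp add: dist_norm norm_minus_commute)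
    from b[OF this] have "((\<lambda>m. (\<Prod>i\<in>Basis. ((x - a) \<bullet> i) ^ m i) *\<^sub>R b (m j)) has_sum g ((x - a) \<bullet> j)) (range e)"
      unfolding has_sum_reindex[OF inj] o_def monom using j by (simp add: e_def)
    then show "((\<lambda>m. (\<Prod>i\<in>Basis. ((x - a) \<bullet> i) ^ m i) *\<^sub>R (if m \<in> range e then b (m j) else 0))
        has_sum g ((x - a) \<bullet> j)) (Basis \<rightarrow>\<^sub>E UNIV)"
      by (rule has_sum_cong_neutral[THEN iffD1, rotated -1]) (auto simp: e_def)
  qed
qed

lemma power_series_on_ball_const: "power_series_on_ball (\<lambda>x. v) a r"
proof -
  obtain j :: 'a where j: "j \<in> Basis" using nonempty_Basis by blast
  have "((\<lambda>n. t ^ n *\<^sub>R (if n = 0 then v else 0)) has_sum v) UNIV" for t :: real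
  proof (rule has_sum_cong_neutral[THEN iffD1, rotated -1])
    show "((\<lambda>n. v) has_sum v) {0::nat}" using has_sum_finite[of "{0::nat}" "\<lambda>n. v"] by simp
  qed auto
  then show ?thesis by (rule power_series_on_ball_univariate[OF j, where g = "\<lambda>_. v"])
qed

text \<open>The coordinate of x is that of x - a plus that of a. The first summand raises the index
  at j by one, the second only scales the coefficients.\<close>

lemma power_series_on_ball_mult_coord:
  assumes j: "j \<in> Basis" and f: "power_series_on_ball f a r"
  shows "power_series_on_ball (\<lambda>x. (x \<bullet> j) *\<^sub>R f x) a r"
proof -
  obtain c where c: "\<And>x. x \<in> ball a r \<Longrightarrow>
      ((\<lambda>m. (\<Prod>i\<in>Basis. ((x - a) \<bullet> i) ^ m i) *\<^sub>R c m) has_sum f x) (Basis \<rightarrow>\<^sub>E UNIV)"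
    using f unfolding power_series_on_ball_def by blast
  have 1: "power_series_on_ball (\<lambda>x. ((x - a) \<bullet> j) *\<^sub>R f x) a r"
    unfolding power_series_on_ball_def
  \<comment> \<open>Indices with m j = 0 do not arise by raising; truncated subtraction would give
    them the coefficient c m instead of 0.\<close>
  proof (intro exI[of _ "\<lambda>m. if m j = 0 then 0 else c (m(j := m j - 1))"] ballI)
    fix x assume x: "x \<in> ball a r"
    let ?p = "\<lambda>m. \<Prod>i\<in>Basis. ((x - a) \<bullet> i) ^ m i"
    have p: "?p (m(j := Suc (m j))) = ((x - a) \<bullet> j) * ?p m" for m
    proof -
      have "?p (m(j := Suc (m j))) = (\<Prod>i\<in>Basis. (if i = j then (x - a) \<bullet> j else 1) * ((x - a) \<bullet> i) ^ m i)"
        by (rule prod.cong) auto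
      also have "\<dots> = ((x - a) \<bullet> j) * ?p m" using j by (simp add: prod.distrib)
      finally show ?thesis .
    qed
    have "((\<lambda>m. ((x - a) \<bullet> j) *\<^sub>R (?p m *\<^sub>R c m)) has_sum ((x - a) \<bullet> j) *\<^sub>R f x) (Basis \<rightarrow>\<^sub>E UNIV)"
      by (rule has_sum_scaleR[OF c[OF x]])
    also have "?this \<longleftrightarrow> ((\<lambda>m. ?p m *\<^sub>R (if m j = 0 then 0 else c (m(j := m j - 1))))
        has_sum ((x - a) \<bullet> j) *\<^sub>R f x) {m \<in> Basis \<rightarrow>\<^sub>E UNIV. m j \<noteq> 0}"
      by (rule has_sum_reindex_bij_witness[of _ "\<lambda>m. m(j := m j - 1)" "\<lambda>m. m(j := Suc (m j))"])
        (use j p in \<open>auto simp: PiE_def extensional_def\<close>)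
    finally show "((\<lambda>m. ?p m *\<^sub>R (if m j = 0 then 0 else c (m(j := m j - 1))))
        has_sum ((x - a) \<bullet> j) *\<^sub>R f x) (Basis \<rightarrow>\<^sub>E UNIV)"
      by (rule has_sum_cong_neutral[THEN iffD1, rotated -1]) auto
  qed
  have 2: "power_series_on_ball (\<lambda>x. (a \<bullet> j) *\<^sub>R f x) a r"
    unfolding power_series_on_ball_def
    by (rule exI[of _ "\<lambda>m. (a \<bullet> j) *\<^sub>R c m"])
      (use has_sum_scaleR[OF c, of _ "a \<bullet> j"] in \<open>simp add: mult.commute\<close>)
  show ?thesis
    using power_series_on_ball_add[OF 1 2] by (simp add: inner_diff_left algebra_simps)
qed

lemma power_series_on_ball_linear:
  assumes "linear A"
  shows "power_series_on_ball A a r"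
proof -
  have "power_series_on_ball (\<lambda>x. \<Sum>j\<in>B. (x \<bullet> j) *\<^sub>R A j) a r" if "B \<subseteq> Basis" for B
    using finite_subset[OF that finite_Basis] that
    by (induction B rule: finite_induct)
      (auto intro!: power_series_on_ball_const power_series_on_ball_add power_series_on_ball_mult_coord)
  moreover have "(\<Sum>j\<in>Basis. (x \<bullet> j) *\<^sub>R A j) = A x" for x
  proof -
    have "A (\<Sum>j\<in>Basis. (x \<bullet> j) *\<^sub>R j) = (\<Sum>j\<in>Basis. (x \<bullet> j) *\<^sub>R A j)"
      by (simp only: linear_sum[OF assms] linear_scale[OF assms])
    then show ?thesis by (simp only: euclidean_representation)
  qed
  ultimately show ?thesis by (metis (no_types, lifting) ext order_refl)
qed

text \<open>Geometric series of 1 / (y + t), where y is the coordinate of a; it converges for |t| <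
  |y|, whence the bound on r.\<close>

lemma power_series_on_ball_inverse_coord:
  assumes j: "j \<in> Basis" and r: "r \<le> \<bar>a \<bullet> j\<bar>" "a \<bullet> j \<noteq> 0"
  shows "power_series_on_ball (\<lambda>x. inverse (x \<bullet> j) *\<^sub>R v) a r"
proof -
  define y where "y = a \<bullet> j"
  have "((\<lambda>n. t ^ n *\<^sub>R (((-1) ^ n / y ^ Suc n) *\<^sub>R v)) has_sum inverse (t + y) *\<^sub>R v) UNIV"
    if t: "\<bar>t\<bar> < r" for t
  proof -
    have q: "norm (- t / y) < 1" using t r by (simp add: y_def abs_divide divide_less_eq_1)
    have "- t / y = t * ((-1) / y)" by simp
    then have eq: "(- t / y) ^ n = t ^ n * ((-1) ^ n / y ^ n)" for n
      by (simp only: power_mult_distrib power_divide)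
    have "((\<lambda>n. (- t / y) ^ n) has_sum (1 / (1 - (- t / y)))) UNIV"
    proof (rule norm_summable_imp_has_sum[OF _ geometric_sums[OF q]])
      have "summable (\<lambda>n. norm (- t / y) ^ n)" using q by (intro summable_geometric) simp
      then show "summable (\<lambda>n. norm ((- t / y) ^ n))" by (simp only: norm_power)
    qed
    then have "((\<lambda>n. (- t / y) ^ n *\<^sub>R (inverse y *\<^sub>R v)) has_sum (1 / (1 - (- t / y))) *\<^sub>R (inverse y *\<^sub>R v)) UNIV"
      by (intro has_sum_bounded_linear[OF bounded_linear_scaleR_left])
    moreover have "1 / (1 - (- t / y)) * inverse y = inverse (t + y)"
      using r by (simp add: y_def field_simps)
    moreover have "(- t / y) ^ n *\<^sub>R (inverse y *\<^sub>R v) = t ^ n *\<^sub>R (((-1) ^ n / y ^ Suc n) *\<^sub>R v)" for n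
      unfolding eq by (simp add: divide_inverse mult_ac)
    ultimately show ?thesis by (simp only: scaleR_scaleR)
  qed
  from power_series_on_ball_univariate[OF j this, where a = a] show ?thesis
    by (simp add: y_def inner_diff_left)
qed

text \<open>Agreement on S suffices, so a closed expression g can be expanded on a ball that leaves
  S; the radius is shrunk afterwards.\<close>

lemma real_analytic_onI:
  assumes "open S" and "\<And>x. x \<in> S \<Longrightarrow> f x = g x"
    and "\<And>a. a \<in> S \<Longrightarrow> \<exists>r>0. power_series_on_ball g a r"
  shows "real_analytic_on f S"
  unfolding real_analytic_on_def
proof
  fix a assume a: "a \<in> S"
  obtain r where r: "r > 0" "power_series_on_ball g a r" using assms(3)[OF a] by blast
  obtain s where s: "s > 0" "ball a s \<subseteq> S" using assms(1) a by (meson open_contains_ball)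
  obtain c where c: "\<And>x. x \<in> ball a r \<Longrightarrow>
      ((\<lambda>m. (\<Prod>i\<in>Basis. ((x - a) \<bullet> i) ^ m i) *\<^sub>R c m) has_sum g x) (Basis \<rightarrow>\<^sub>E UNIV)"
    using r(2) unfolding power_series_on_ball_def by blast
  show "\<exists>r>0. \<exists>c. ball a r \<subseteq> S \<and> (\<forall>x\<in>ball a r.
      ((\<lambda>m. (\<Prod>i\<in>Basis. ((x - a) \<bullet> i) ^ m i) *\<^sub>R c m) has_sum f x) (Basis \<rightarrow>\<^sub>E UNIV))"
  proof (intro exI[of _ "min r s"] exI[of _ c] conjI ballI)
    show "ball a (min r s) \<subseteq> S" using s(2) by auto
    fix x assume x: "x \<in> ball a (min r s)"
    then have "x \<in> ball a r" "x \<in> S" using s(2) by auto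
    then show "((\<lambda>m. (\<Prod>i\<in>Basis. ((x - a) \<bullet> i) ^ m i) *\<^sub>R c m) has_sum f x) (Basis \<rightarrow>\<^sub>E UNIV)"
      using c assms(2) by simp
  qed (use r s in auto)
qed

section \<open>The map \<open>\<Pi> \<times> \<Xi>\<close> and its inverse\<close>

text \<open>The inverse of \<open>Tor_PiXi\<close> on the upper half-plane: (a, b) are the real
  coordinates with z2 = a \<tau> - b.\<close>

definition Tor_point :: "complex \<times> real \<times> real \<Rightarrow> complex \<times> complex" where
  "Tor_point = (\<lambda>(\<tau>, a, b). (\<tau>, of_real a * \<tau> - of_real b))"

lemma Tor_PiXi_Tor_point:
  assumes "Im \<tau> > 0"
  shows "Tor_PiXi (Tor_point (\<tau>, r)) = (\<tau>, r)"
  using assms by (cases r) (simp add: Tor_PiXi_def Tor_point_def Tor_proj_def Tor_Xi_def)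

lemma Tor_point_Tor_PiXi:
  assumes "Im (fst p) > 0"
  shows "Tor_point (Tor_PiXi p) = p"
  using assms
  by (cases p) (simp add: Tor_PiXi_def Tor_point_def Tor_proj_def Tor_Xi_def complex_eq_iff)

lemma Tor_point_in_Tor12:
  assumes "Im \<tau> > 0"
  shows "Tor_point (\<tau>, r) \<in> Tor12 \<longleftrightarrow> r \<in> punctured_R2"
proof (cases r)
  case (Pair a b)
  have "of_real a * \<tau> - of_real b \<in> lattice \<tau> \<longleftrightarrow> a \<in> \<int> \<and> b \<in> \<int>"
  proof
    assume "of_real a * \<tau> - of_real b \<in> lattice \<tau>"
    then obtain m n :: int where eq: "of_real a * \<tau> - of_real b = of_int m + of_int n * \<tau>"
      by (auto simp: lattice_def)
    from arg_cong[OF eq, of Im] assms have a: "a = of_int n" by simp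
    from arg_cong[OF eq, of Re] have "b = of_int (- m)" by (simp add: a)
    then show "a \<in> \<int> \<and> b \<in> \<int>" using a by simp
  next
    assume "a \<in> \<int> \<and> b \<in> \<int>"
    then obtain n m where "a = of_int n" "b = of_int m" by (auto elim!: Ints_cases)
    then have "of_real a * \<tau> - of_real b = of_int (- m) + of_int n * \<tau>" by simp
    then show "of_real a * \<tau> - of_real b \<in> lattice \<tau>" unfolding lattice_def by blast
  qed
  then show ?thesis
    using assms by (simp add: Pair Tor_point_def Tor12_def upper_half_plane_def punctured_R2_def)
qed

lemma Tor12_iff: "p \<in> Tor12 \<longleftrightarrow> Im (fst p) > 0 \<and> Tor_Xi p \<in> punctured_R2"
proof (cases "Im (fst p) > 0")
  case True
  have "p \<in> Tor12 \<longleftrightarrow> Tor_point (fst p, Tor_Xi p) \<in> Tor12"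
    using Tor_point_Tor_PiXi[OF True] by (simp add: Tor_PiXi_def Tor_proj_def case_prod_beta)
  then show ?thesis using Tor_point_in_Tor12[OF True] True by simp
qed (auto simp: Tor12_def upper_half_plane_def)

lemma bij_betw_Tor_PiXi: "bij_betw Tor_PiXi Tor12 (upper_half_plane \<times> punctured_R2)"
proof (rule bij_betw_byWitness[where f' = Tor_point])
  show "\<forall>p\<in>Tor12. Tor_point (Tor_PiXi p) = p"
    using Tor_point_Tor_PiXi Tor12_iff by blast
  show "\<forall>q\<in>upper_half_plane \<times> punctured_R2. Tor_PiXi (Tor_point q) = q"
    using Tor_PiXi_Tor_point by (auto simp: upper_half_plane_def)
  show "Tor_PiXi ` Tor12 \<subseteq> upper_half_plane \<times> punctured_R2"
    unfolding Tor_PiXi_def Tor_proj_def case_prod_beta Tor12_iff upper_half_plane_def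
    using Tor12_iff by auto
  show "Tor_point ` (upper_half_plane \<times> punctured_R2) \<subseteq> Tor12"
    using Tor_point_in_Tor12 by (auto simp: upper_half_plane_def)
qed

lemma open_upper_half_plane: "open upper_half_plane"
  unfolding upper_half_plane_def by (rule open_halfspace_Im_gt)

lemma open_punctured_R2: "open punctured_R2"
  unfolding punctured_R2_def by (intro open_Diff open_UNIV closed_Times closed_Ints)

lemma continuous_on_Tor_Xi: "continuous_on {p. Im (fst p) > 0} Tor_Xi"
  unfolding Tor_Xi_def case_prod_beta by (intro continuous_intros) auto

lemma open_Tor12: "open Tor12"
proof -
  have "open {p::complex \<times> complex. Im (fst p) > 0}"
    by (intro open_Collect_less continuous_intros)
  from continuous_open_preimage[OF continuous_on_Tor_Xi this open_punctured_R2]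
  have "open ({p. Im (fst p) > 0} \<inter> Tor_Xi -` punctured_R2)" .
  also have "{p. Im (fst p) > 0} \<inter> Tor_Xi -` punctured_R2 = Tor12" using Tor12_iff by blast
  finally show ?thesis .
qed

lemma real_analytic_iso_Tor_PiXi:
  "real_analytic_iso Tor_PiXi Tor12 (upper_half_plane \<times> punctured_R2)"
  unfolding real_analytic_iso_def
proof (intro conjI bij_betw_Tor_PiXi)
  show "real_analytic_on Tor_PiXi Tor12"
  proof (rule real_analytic_onI[OF open_Tor12])
    \<comment> \<open>The inner products with (0, \<i>), (\<i>, 0) and (1, 0) are Im z2, Im \<tau>
      and Re \<tau>; so the map is built from a linear one and from coordinate multiples of 1 / Im
      \<tau>.\<close>
    let ?g = "\<lambda>p::complex \<times> complex. (fst p, 0, - Re (snd p)) +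
        ((p \<bullet> (0, \<i>)) *\<^sub>R (inverse (p \<bullet> (\<i>, 0)) *\<^sub>R (0, 1, 0)) +
         (p \<bullet> (0, \<i>)) *\<^sub>R ((p \<bullet> (1, 0)) *\<^sub>R (inverse (p \<bullet> (\<i>, 0)) *\<^sub>R (0, 0, 1)))) :: complex \<times> real \<times> real"
    show "Tor_PiXi p = ?g p" if "p \<in> Tor12" for p
    proof (cases p)
      case (Pair \<tau> z)
      have "Re (of_real (Im z / Im \<tau>) * \<tau> - z) = Im z / Im \<tau> * Re \<tau> - Re z"
        by (simp del: of_real_divide)
      then show ?thesis
        by (simp add: Pair Tor_PiXi_def Tor_proj_def Tor_Xi_def inner_complex_def divide_inverse del: of_real_mult)
    qed
    fix p assume "p \<in> Tor12"
    then have pos: "p \<bullet> (\<i>, 0) > 0" by (simp add: Tor12_iff inner_prod_def inner_complex_def)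
    have B: "(\<i>, 0::complex) \<in> Basis" "(1::complex, 0::complex) \<in> Basis" "(0::complex, \<i>) \<in> Basis"
      by (simp_all add: Basis_prod_def)
    have "linear (\<lambda>p::complex \<times> complex. (fst p, 0::real, - Re (snd p)))"
      by (rule linearI) simp_all
    note 1 = power_series_on_ball_linear[OF this]
    have 2: "power_series_on_ball (\<lambda>x. inverse (x \<bullet> (\<i>, 0)) *\<^sub>R v) p \<bar>p \<bullet> (\<i>, 0)\<bar>" for v :: "complex \<times> real \<times> real"
      using pos by (intro power_series_on_ball_inverse_coord[OF B(1)]) simp_all
    have "power_series_on_ball ?g p \<bar>p \<bullet> (\<i>, 0)\<bar>"
      by (rule power_series_on_ball_add[OF 1 power_series_on_ball_add[OF
        power_series_on_ball_mult_coord[OF B(3) 2] power_series_on_ball_mult_coord[OF B(3)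
          power_series_on_ball_mult_coord[OF B(2) 2]]]])
    then show "\<exists>r>0. power_series_on_ball ?g p r" using pos by (intro exI[of _ "\<bar>p \<bullet> (\<i>, 0)\<bar>"]) simp
  qed
  show "real_analytic_on (inv_into Tor12 Tor_PiXi) (upper_half_plane \<times> punctured_R2)"
  proof (rule real_analytic_onI[OF open_Times[OF open_upper_half_plane open_punctured_R2]])
    let ?g = "\<lambda>q::complex \<times> real \<times> real. (fst q, - of_real (snd (snd q))) + (q \<bullet> (0, 1, 0)) *\<^sub>R (0, fst q)"
    show "inv_into Tor12 Tor_PiXi q = ?g q" if q: "q \<in> upper_half_plane \<times> punctured_R2" for q
    proof -
      obtain \<tau> a b where q': "q = (\<tau>, a, b)" by (cases q)
      have "Tor_point q \<in> Tor12" "Tor_PiXi (Tor_point q) = q"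
        using q unfolding q' by (simp_all add: upper_half_plane_def Tor_point_in_Tor12 Tor_PiXi_Tor_point)
      then have "inv_into Tor12 Tor_PiXi q = Tor_point q"
        using bij_betw_Tor_PiXi by (metis bij_betw_def inv_into_f_f)
      also have "\<dots> = ?g q" by (simp add: q' Tor_point_def scaleR_conv_of_real)
      finally show ?thesis .
    qed
    fix q :: "complex \<times> real \<times> real"
    have "linear (\<lambda>q::complex \<times> real \<times> real. (fst q, - complex_of_real (snd (snd q))))"
      "linear (\<lambda>q::complex \<times> real \<times> real. (0::complex, fst q))"
      by (rule linearI; simp add: scaleR_conv_of_real)+
    note 1 = this[THEN power_series_on_ball_linear]
    have "(0::complex, 1::real, 0::real) \<in> Basis" by (simp add: Basis_prod_def)
    from power_series_on_ball_add[OF 1(1) power_series_on_ball_mult_coord[OF this 1(2)]]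
    have "power_series_on_ball ?g q 1" .
    \<comment> \<open>The inverse is polynomial in the real coordinates, so any radius
      serves.\<close>
    then show "\<exists>r>0. power_series_on_ball ?g q r" by (intro exI[of _ 1]) simp
  qed
qed

section \<open>The leaves\<close>

text \<open>The fibre of \<open>Tor_Xi\<close> over r (see \<open>mem_leaf_iff\<close>), encoded by
  its parametrization so that its topology can be read off.\<close>

definition leaf :: "real \<times> real \<Rightarrow> (complex \<times> complex) set" where
  "leaf r = (\<lambda>\<tau>. Tor_point (\<tau>, r)) ` upper_half_plane"

lemma Tor_Xi_Tor_point: "Im \<tau> > 0 \<Longrightarrow> Tor_Xi (Tor_point (\<tau>, r)) = r"
  using Tor_PiXi_Tor_point[of \<tau> r] by (simp add: Tor_PiXi_def)

lemma mem_leaf_iff: "p \<in> leaf r \<longleftrightarrow> Im (fst p) > 0 \<and> Tor_Xi p = r"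
proof
  assume "p \<in> leaf r"
  then obtain \<tau> where \<tau>: "Im \<tau> > 0" "p = Tor_point (\<tau>, r)" by (auto simp: leaf_def upper_half_plane_def)
  then have "fst p = \<tau>" "Tor_Xi p = r"
    using Tor_Xi_Tor_point[OF \<tau>(1)] by (simp_all add: Tor_point_def case_prod_beta)
  then show "Im (fst p) > 0 \<and> Tor_Xi p = r" using \<tau>(1) by simp
next
  assume p: "Im (fst p) > 0 \<and> Tor_Xi p = r"
  then have "p = Tor_point (fst p, r)"
    using Tor_point_Tor_PiXi[of p] by (simp add: Tor_PiXi_def Tor_proj_def case_prod_beta)
  then show "p \<in> leaf r" using p unfolding leaf_def upper_half_plane_def by blast
qed

lemma Tor_PiXi_image_leaf: "Tor_PiXi ` leaf r = upper_half_plane \<times> {r}"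
proof -
  have "Tor_PiXi ` leaf r = (\<lambda>\<tau>. (\<tau>, r)) ` upper_half_plane"
    unfolding leaf_def image_image
    by (rule image_cong[OF refl]) (simp add: Tor_PiXi_Tor_point upper_half_plane_def)
  then show ?thesis by auto
qed

lemma homeomorphism_leaf: "homeomorphism upper_half_plane (leaf r) (\<lambda>\<tau>. Tor_point (\<tau>, r)) Tor_proj"
  unfolding homeomorphism_def leaf_def
  by (cases r) (auto simp: Tor_point_def Tor_proj_def case_prod_beta image_image intro!: continuous_intros)

lemma contractible_leaf: "contractible (leaf r)"
proof -
  have "convex upper_half_plane" unfolding upper_half_plane_def by (rule convex_halfspace_Im_gt)
  then show ?thesis
    using homeomorphic_contractible[OF convex_imp_contractible] homeomorphism_leaf
    unfolding homeomorphic_def by blast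
qed

text \<open>For fixed r = (a, b) the section of \<open>Tor_proj\<close> sending \<tau> to (\<tau>, a
  \<tau> - b) is affine in \<tau>, hence a single holomorphic parametrization of the whole
  leaf.\<close>

lemma biholomorphism_leaf: "biholomorphism_curve Tor_proj (leaf r) upper_half_plane"
proof -
  let ?g = "\<lambda>\<tau>. Tor_point (\<tau>, r)"
  have hol: "holomorphic_into_C2 ?g upper_half_plane"
    by (cases r) (auto simp: holomorphic_into_C2_def Tor_point_def intro!: holomorphic_intros)
  have fst: "(\<lambda>u. fst (?g u)) = (\<lambda>u. u)" by (cases r) (simp add: Tor_point_def)
  have "curve_parametrization (leaf r) upper_half_plane ?g"
    unfolding curve_parametrization_def fst
    using hol open_upper_half_plane homeomorphism_leaf[of r] by (auto simp: leaf_def)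
  then have "complex_curve (leaf r)" unfolding complex_curve_def leaf_def by blast
  moreover have bij: "bij_betw Tor_proj (leaf r) upper_half_plane"
    using homeomorphism_leaf[of r] unfolding homeomorphism_def
    by (intro bij_betw_byWitness[where f' = ?g]) auto
  moreover have "holomorphic_on_curve Tor_proj (leaf r)"
    by (auto simp: holomorphic_on_curve_def curve_parametrization_def holomorphic_into_C2_def Tor_proj_def case_prod_beta)
  moreover have "holomorphic_into_C2 (inv_into (leaf r) Tor_proj) upper_half_plane"
  proof -
    have "inv_into (leaf r) Tor_proj \<tau> = ?g \<tau>" if "\<tau> \<in> upper_half_plane" for \<tau>
    proof (rule inv_into_f_eq)
      show "inj_on Tor_proj (leaf r)" using bij by (rule bij_betw_imp_inj_on)
      show "?g \<tau> \<in> leaf r" using that by (auto simp: leaf_def)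
      show "Tor_proj (?g \<tau>) = \<tau>" by (cases r) (simp add: Tor_point_def Tor_proj_def)
    qed
    then show ?thesis
      using hol unfolding holomorphic_into_C2_def by (auto intro: holomorphic_transform)
  qed
  ultimately show ?thesis
    using open_upper_half_plane unfolding biholomorphism_curve_def by blast
qed

section \<open>Level sets of the holonomy map\<close>

text \<open>\<alpha> (y - x) is an integer of absolute value below 1, hence 0.\<close>

lemma cis_scaled_inj:
  fixes x y \<alpha> :: real
  assumes "0 < \<alpha>" "\<alpha> < 1" "\<bar>y - x\<bar> < 1" "cis (2 * pi * \<alpha> * x) = cis (2 * pi * \<alpha> * y)"
  shows "x = y"
proof -
  have "sin (2 * pi * \<alpha> * y) = sin (2 * pi * \<alpha> * x) \<and> cos (2 * pi * \<alpha> * y) = cos (2 * pi * \<alpha> * x)"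
    using assms(4) by (simp add: complex_eq_iff)
  then obtain n :: int where "2 * pi * \<alpha> * y = 2 * pi * \<alpha> * x + 2 * pi * n"
    unfolding sin_cos_eq_iff by blast
  then have "2 * pi * (\<alpha> * (y - x)) = 2 * pi * n" by (simp add: algebra_simps)
  then have n: "\<alpha> * (y - x) = n" by simp
  have "\<bar>\<alpha> * (y - x)\<bar> \<le> 1 * \<bar>y - x\<bar>" unfolding abs_mult using assms by (intro mult_right_mono) auto
  then have "\<bar>real_of_int n\<bar> < 1" using n assms(3) by simp
  then have "n = 0" by linarith
  then show ?thesis using n assms(1) by simp
qed

lemma holonomy_map_Tor_Xi:
  assumes \<alpha>: "0 < \<alpha>\<^sub>1" "\<alpha>\<^sub>1 < 1" and p: "p \<in> Tor12"
  shows "holonomy_map \<alpha>\<^sub>1 p = (cis (2 * pi * \<alpha>\<^sub>1 * (fst (Tor_Xi p) - of_int \<lfloor>fst (Tor_Xi p)\<rfloor>)),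
     cis (2 * pi * \<alpha>\<^sub>1 * (snd (Tor_Xi p) - of_int \<lceil>snd (Tor_Xi p)\<rceil>)))"
proof -
  obtain \<tau> z where q: "p = (\<tau>, z)" by (cases p)
  have \<tau>: "Im \<tau> > 0" and z: "z \<notin> lattice \<tau>" using p by (auto simp: q Tor12_def upper_half_plane_def)
  have "Tor_point (\<tau>, Tor_Xi p) = p"
    using Tor_point_Tor_PiXi[of p] \<tau> by (simp add: Tor_PiXi_def Tor_proj_def q)
  then have "z = of_real (fst (Tor_Xi p)) * \<tau> - of_real (snd (Tor_Xi p))"
    by (simp add: Tor_point_def q case_prod_beta)
  from holonomy_map_eq[OF \<alpha> \<tau> z this] show ?thesis unfolding q .
qed

lemma holonomy_map_eq_imp_Ints:
  assumes \<alpha>: "0 < \<alpha>\<^sub>1" "\<alpha>\<^sub>1 < 1" and pq: "p \<in> Tor12" "q \<in> Tor12" "holonomy_map \<alpha>\<^sub>1 p = holonomy_map \<alpha>\<^sub>1 q"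
  shows "Tor_Xi q - Tor_Xi p \<in> \<int> \<times> \<int>"
proof -
  obtain a b where p: "Tor_Xi p = (a, b)" by (cases "Tor_Xi p")
  obtain c d where q: "Tor_Xi q = (c, d)" by (cases "Tor_Xi q")
  have "cis (2 * pi * \<alpha>\<^sub>1 * (a - of_int \<lfloor>a\<rfloor>)) = cis (2 * pi * \<alpha>\<^sub>1 * (c - of_int \<lfloor>c\<rfloor>))"
    "cis (2 * pi * \<alpha>\<^sub>1 * (b - of_int \<lceil>b\<rceil>)) = cis (2 * pi * \<alpha>\<^sub>1 * (d - of_int \<lceil>d\<rceil>))"
    using pq(3) unfolding holonomy_map_Tor_Xi[OF \<alpha> pq(1)] holonomy_map_Tor_Xi[OF \<alpha> pq(2)] by (simp_all add: p q)
  \<comment> \<open>Here a - floor a lies in [0, 1) and b - ceiling b in (-1, 0], and likewise for c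
    and d, so the differences stay below 1 in absolute value.\<close>
  then have "a - of_int \<lfloor>a\<rfloor> = c - of_int \<lfloor>c\<rfloor>" "b - of_int \<lceil>b\<rceil> = d - of_int \<lceil>d\<rceil>"
    using \<alpha> by (auto intro!: cis_scaled_inj[of \<alpha>\<^sub>1]; linarith)+
  then have "c - a = of_int (\<lfloor>c\<rfloor> - \<lfloor>a\<rfloor>)" "d - b = of_int (\<lceil>d\<rceil> - \<lceil>b\<rceil>)" by simp_all
  then show ?thesis by (simp add: p q)
qed

text \<open>The fibre is connected and lies in the level set because the holonomy depends on
  \<open>Tor_Xi\<close> alone. Conversely, on the component the continuous map \<open>Tor_Xi\<close>
  takes values in one coset of the integer vectors, which is discrete.\<close>

lemma connected_component_level_set:
  assumes \<alpha>: "0 < \<alpha>\<^sub>1" "\<alpha>\<^sub>1 < 1" and p: "p \<in> Tor12"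
  shows "connected_component_set {q \<in> Tor12. holonomy_map \<alpha>\<^sub>1 q = holonomy_map \<alpha>\<^sub>1 p} p = leaf (Tor_Xi p)"
    (is "connected_component_set ?V p = _")
proof
  have V: "p \<in> ?V" using p by simp
  show "leaf (Tor_Xi p) \<subseteq> connected_component_set ?V p"
  proof (rule connected_component_maximal)
    show "p \<in> leaf (Tor_Xi p)" using p by (simp add: mem_leaf_iff Tor12_iff)
    show "connected (leaf (Tor_Xi p))" by (rule contractible_imp_connected[OF contractible_leaf])
    show "leaf (Tor_Xi p) \<subseteq> ?V"
    proof
      fix q assume "q \<in> leaf (Tor_Xi p)"
      then have q: "q \<in> Tor12" "Tor_Xi q = Tor_Xi p" using p by (simp_all add: mem_leaf_iff Tor12_iff)
      then show "q \<in> ?V" using holonomy_map_Tor_Xi[OF \<alpha>] p by simp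
    qed
  qed
  let ?C = "connected_component_set ?V p"
  have sub: "?C \<subseteq> ?V" by (rule connected_component_subset)
  \<comment> \<open>F packs \<open>Tor_Xi\<close> into one complex number: if two values differ, the
    real or the imaginary part of the difference is a nonzero integer, so its modulus is at least
    1.\<close>
  define F where "F q = of_real (fst (Tor_Xi q)) + \<i> * of_real (snd (Tor_Xi q))" for q
  have "F constant_on ?C"
  proof (rule continuous_discrete_range_constant[OF connected_connected_component])
    have "continuous_on ?C Tor_Xi"
      by (rule continuous_on_subset[OF continuous_on_Tor_Xi]) (use sub in \<open>auto simp: Tor12_iff\<close>)
    then show "continuous_on ?C F" unfolding F_def by (intro continuous_intros)
    fix x assume x: "x \<in> ?C"
    have "1 \<le> norm (F y - F x)" if y: "y \<in> ?C" "F y \<noteq> F x" for y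
    proof -
      have xy: "x \<in> Tor12" "y \<in> Tor12" "holonomy_map \<alpha>\<^sub>1 x = holonomy_map \<alpha>\<^sub>1 y"
        using subsetD[OF sub x] subsetD[OF sub y(1)] by simp_all
      have "Re (F y - F x) \<in> \<int>" "Im (F y - F x) \<in> \<int>"
        using holonomy_map_eq_imp_Ints[OF \<alpha> xy] by (simp_all add: F_def mem_Times_iff)
      moreover have "Re (F y - F x) \<noteq> 0 \<or> Im (F y - F x) \<noteq> 0"
        using y(2) by (simp add: complex_eq_iff)
      ultimately have "1 \<le> \<bar>Re (F y - F x)\<bar> \<or> 1 \<le> \<bar>Im (F y - F x)\<bar>"
        using Ints_nonzero_abs_ge1 by blast
      then show ?thesis using abs_Re_le_cmod[of "F y - F x"] abs_Im_le_cmod[of "F y - F x"] by linarith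
    qed
    then show "\<exists>e>0. \<forall>y. y \<in> ?C \<and> F y \<noteq> F x \<longrightarrow> e \<le> norm (F y - F x)"
      by (intro exI[of _ 1]) auto
  qed
  moreover have "p \<in> ?C" using V connected_component_refl by simp
  ultimately have F: "F q = F p" if "q \<in> ?C" for q
    using that unfolding constant_on_def by metis
  have "Tor_Xi q = Tor_Xi p" if "q \<in> ?C" for q
    using F[OF that] by (simp add: F_def complex_eq_iff prod_eq_iff)
  then show "?C \<subseteq> leaf (Tor_Xi p)"
    using sub by (auto simp: mem_leaf_iff Tor12_iff)
qed

lemma veech_foliation_eq:
  assumes \<alpha>: "0 < \<alpha>\<^sub>1" "\<alpha>\<^sub>1 < 1"
  shows "veech_foliation \<alpha>\<^sub>1 = leaf ` punctured_R2"
proof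
  show "veech_foliation \<alpha>\<^sub>1 \<subseteq> leaf ` punctured_R2"
  proof
    fix L assume "L \<in> veech_foliation \<alpha>\<^sub>1"
    then obtain \<zeta> p where p: "p \<in> Tor12" "holonomy_map \<alpha>\<^sub>1 p = \<zeta>"
      "L = connected_component_set {q \<in> Tor12. holonomy_map \<alpha>\<^sub>1 q = \<zeta>} p"
      by (auto simp: veech_foliation_def components_def)
    then have "L = leaf (Tor_Xi p)" using connected_component_level_set[OF \<alpha> p(1)] by simp
    then show "L \<in> leaf ` punctured_R2" using p(1) by (auto simp: Tor12_iff)
  qed
  show "leaf ` punctured_R2 \<subseteq> veech_foliation \<alpha>\<^sub>1"
  proof
    fix L assume "L \<in> leaf ` punctured_R2"
    then obtain r where r: "r \<in> punctured_R2" "L = leaf r" by blast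
    \<comment> \<open>Any point of the leaf can serve; this is the one over \<i>.\<close>
    define p where "p = Tor_point (\<i>, r)"
    have p: "p \<in> Tor12" "Tor_Xi p = r"
      using r(1) by (simp_all add: p_def Tor_point_in_Tor12 Tor_Xi_Tor_point)
    have "L = connected_component_set {q \<in> Tor12. holonomy_map \<alpha>\<^sub>1 q = holonomy_map \<alpha>\<^sub>1 p} p"
      using connected_component_level_set[OF \<alpha> p(1)] p(2) r(2) by simp
    then have "L \<in> components {q \<in> Tor12. holonomy_map \<alpha>\<^sub>1 q = holonomy_map \<alpha>\<^sub>1 p}"
      using p(1) by (auto simp: components_def)
    then show "L \<in> veech_foliation \<alpha>\<^sub>1" unfolding veech_foliation_def by blast
  qed
qed

theorem proposition1p7:
  fixes \<alpha>\<^sub>1 :: real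
  assumes "0 < \<alpha>\<^sub>1" and "\<alpha>\<^sub>1 < 1"
  shows "real_analytic_iso Tor_PiXi Tor12 (upper_half_plane \<times> punctured_R2) \<and>
    pushforward_foliation Tor_PiXi (veech_foliation \<alpha>\<^sub>1)
      = horizontal_foliation upper_half_plane punctured_R2 \<and>
    (\<forall>L\<in>veech_foliation \<alpha>\<^sub>1. biholomorphism_curve Tor_proj L upper_half_plane) \<and>
    (\<forall>L\<in>veech_foliation \<alpha>\<^sub>1. contractible L)"
proof (intro conjI)
  show "pushforward_foliation Tor_PiXi (veech_foliation \<alpha>\<^sub>1)
      = horizontal_foliation upper_half_plane punctured_R2"
    unfolding pushforward_foliation_def horizontal_foliation_def veech_foliation_eq[OF assms]
      image_image Tor_PiXi_image_leaf by blast
qed (auto simp: veech_foliation_eq[OF assms] real_analytic_iso_Tor_PiXi biholomorphism_leaf contractible_leaf)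

end
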